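(* As $n \to \infty$, we have $$\sum_{f \in M_n} \omega_1^2(f) = q^n(\log n)^2 + c_2\, q^n \log n + c_3\, q^n + O\left(\frac{q^n \log n}{n}\right),$$ where $$c_2 := 1 + 2A_1 - 2L(2)$$ and $$c_3 := (A_1 - 2L(2))(A_1 + 1) - \frac{\pi^2}{6} + (L(2))^2 + 2L(3) - L(4).$$ Moreover, for $k \geq 2$, we have $$\sum_{f \in M_n} \omega_k^2(f) = c_k'\, q^n + O\left(n \cdot q^{\frac{n}{k}}\right),$$ where $$c_k' := (L(k) - L(k+1))(L(k) - L(k+1) + 1) - L(2k) + 2L(2k+1) - L(2k+2).$$
   Context: $\mathbb{F}_q$ is the finite field with $q$ elements ($q$ a fixed prime power), and $\mathbb{F}_q[t]$ is its polynomial ring. $P$ is the set of monic irreducible polynomials in $\mathbb{F}_q[t]$; for $n \ge 1$, $M_n$ is the set of monic polynomials of degree $n$ in $\mathbb{F}_q[t]$. For $f \in \mathbb{F}_q[t]$ nonzero, $|f| := q^{\deg(f)}$. For $l \in P$ and a monic $f$, $\nu_l(f)$ is the largest nonnegative integer with $l^{\nu_l(f)} \mid f$. For $k \ge 1$, $\omega_k(f)$ is the number of $l \in P$ with $\nu_l(f) = k$, and $\omega_k^2(f)$ means $(\omega_k(f))^2$. $\pi_q(r)$ is the number of $l \in P$ with $\deg(l) = r$. $\gamma$ is the Euler--Mascheroni constant, $c_1 := \sum_{r=1}^{\infty} \left(\pi_q(r) - \frac{q^r}{r}\right) q^{-r}$, and $A_1 := \gamma + c_1$. For an integer $m \geq 2$,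 $L(m) := \sum_{l \in P} \frac{1}{|l|^m}$. $O$-estimates are as $n \to \infty$ with $q$ and $k$ fixed. *)

theory Defs
  imports
    "HOL-Analysis.Analysis"
    "HOL-Computational_Algebra.Polynomial_Factorial"
    "HOL-Library.Landau_Symbols"
begin

text \<open>
  The finite field with \<open>q\<close> elements is a type \<open>'a\<close> of sort \<open>{field, finite}\<close>, and \<open>q = CARD('a)\<close>.
  Quantities that depend only on the field take an argument of type \<open>'a itself\<close>.
\<close>

definition monic_irreducibles :: "'a::{field,finite} poly set" where
  "monic_irreducibles = {l. lead_coeff l = 1 \<and> irreducible l}"

definition monics_of_degree :: "nat \<Rightarrow> 'a::{field,finite} poly set" where
  "monics_of_degree n = {f. lead_coeff f = 1 \<and> degree f = n}"

definition poly_size :: "'a::{field,finite} poly \<Rightarrow> nat" where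
  "poly_size f = CARD('a) ^ degree f"

text \<open>The library's \<open>multiplicity\<close> would force a sort with gcd structure on the coefficient field.
  The set below is finite whenever \<open>l\<close> is irreducible and \<open>f \<noteq> 0\<close>; otherwise \<open>Max\<close> is unspecified.\<close>

definition nu :: "'a::{field,finite} poly \<Rightarrow> 'a poly \<Rightarrow> nat" where
  "nu l f = Max {m. l ^ m dvd f}"

definition omega :: "nat \<Rightarrow> 'a::{field,finite} poly \<Rightarrow> nat" where
  "omega k f = card {l \<in> monic_irreducibles. nu l f = k}"

definition irreducible_count :: "'a::{field,finite} itself \<Rightarrow> nat \<Rightarrow> nat" where
  "irreducible_count _ r = card {l \<in> (monic_irreducibles :: 'a poly set). degree l = r}"

text \<open>The summation index is shifted by one, so that the series starts at \<open>r = 1\<close>.\<close>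

definition c1 :: "'a::{field,finite} itself \<Rightarrow> real" where
  "c1 K = (\<Sum>i. let r = Suc i in
     (real (irreducible_count K r) - real CARD('a) ^ r / real r) / real CARD('a) ^ r)"

definition A1 :: "'a::{field,finite} itself \<Rightarrow> real" where
  "A1 K = euler_mascheroni + c1 K"

text \<open>Only meaningful for \<open>m \<ge> 2\<close>: the family is not summable for \<open>m \<le> 1\<close>, and then
  \<open>infsum\<close> is \<open>0\<close> by convention.\<close>

definition L :: "'a::{field,finite} itself \<Rightarrow> nat \<Rightarrow> real" where
  "L _ m = (\<Sum>\<^sub>\<infinity>l\<in>(monic_irreducibles :: 'a poly set). 1 / real (poly_size l) ^ m)"

definition c2 :: "'a::{field,finite} itself \<Rightarrow> real" where
  "c2 K = 1 + 2 * A1 K - 2 * L K 2"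

definition c3 :: "'a::{field,finite} itself \<Rightarrow> real" where
  "c3 K = (A1 K - 2 * L K 2) * (A1 K + 1) - pi\<^sup>2 / 6 + (L K 2)\<^sup>2 + 2 * L K 3 - L K 4"

definition c' :: "'a::{field,finite} itself \<Rightarrow> nat \<Rightarrow> real" where
  "c' K k = (L K k - L K (k + 1)) * (L K k - L K (k + 1) + 1)
     - L K (2 * k) + 2 * L K (2 * k + 1) - L K (2 * k + 2)"

end

theory Submission
  imports Defs "HOL-Real_Asymp.Real_Asymp"
begin

text \<open>
  Write \<open>q\<close> for the size of the field.  Squaring
  \<open>omega k f = (\<Sum>l. [l ^ k dvd f] - [l ^ (k + 1) dvd f])\<close> and summing over all monic \<open>f\<close> of
  degree \<open>n\<close> leads to counting multiples of \<open>l ^ a * l' ^ b\<close>, of which there are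
  \<open>q ^ (n - a * deg l - b * deg l')\<close>, or none if the exponent would be negative.  Let \<open>u\<^sub>m(j)\<close> be the
  sum of the terms of the series \<open>L(m)\<close> that equal \<open>q ^ (- j)\<close>, let \<open>D\<^sub>m(n) = (\<Sum>j\<le>n. u\<^sub>m(j))\<close> and
  \<open>T\<^sub>a\<^sub>,\<^sub>b(n) = (\<Sum>i + j \<le> n. u\<^sub>a(i) u\<^sub>b(j))\<close>.  Then, with \<open>k' = k + 1\<close>, the second moment equals
  \<open>q ^ n * (D\<^sub>k - D\<^sub>k\<^sub>' + T\<^sub>k\<^sub>,\<^sub>k - 2 T\<^sub>k\<^sub>,\<^sub>k\<^sub>' + T\<^sub>k\<^sub>'\<^sub>,\<^sub>k\<^sub>' - D\<^sub>k\<^sub>+\<^sub>k + 2 D\<^sub>k\<^sub>+\<^sub>k\<^sub>' - D\<^sub>k\<^sub>'\<^sub>+\<^sub>k\<^sub>')\<close>,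
  everything taken at \<open>n\<close> (\<open>sum_omega_sq_eq\<close>); the last three terms remove the diagonal \<open>l = l'\<close> from the double
  sums.

  For \<open>k \<ge> 2\<close> all indices \<open>m\<close> that occur are at least \<open>k\<close>, and \<open>u\<^sub>m(j) \<le> q powr (j/k - j)\<close>.  So
  \<open>D\<^sub>m\<close> tends to \<open>L(m)\<close> and \<open>T\<^sub>a\<^sub>,\<^sub>b\<close> to the Cauchy product \<open>L(a) L(b)\<close>, with an error
  \<open>O(n * q powr (n/k - n))\<close>.

  For \<open>k = 1\<close> the series for \<open>m = 1\<close> diverges.  The prime polynomial theorem with error term,
  \<open>u\<^sub>1(j) = 1/j + \<epsilon>\<^sub>j\<close> with \<open>\<epsilon>\<^sub>j\<close> exponentially small (\<open>prime_error_bound\<close>), compares it with the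
  harmonic series: \<open>D\<^sub>1(n) = H\<^sub>n + (\<Sum>j\<le>n. \<epsilon>\<^sub>j)\<close>, where the \<open>\<epsilon>\<^sub>j\<close> sum up to \<open>c1\<close>.  The main part of
  \<open>T\<^sub>1\<^sub>,\<^sub>1\<close> is \<open>(\<Sum>i + j \<le> n. 1/(i j)) = H\<^sub>n\<^sup>2 - (\<Sum>j\<le>n. 1/j\<^sup>2)\<close> (\<open>harm_triangle\<close>), which is where
  \<open>\<pi>\<^sup>2/6\<close> comes from.  The rest of \<open>T\<^sub>1\<^sub>,\<^sub>1\<close>, and \<open>T\<^sub>2\<^sub>,\<^sub>1\<close>, are convolutions of an exponentially
  small sequence with \<open>H\<close> or \<open>D\<^sub>1\<close>.  The latter vary so slowly that the convolution is their value
  at \<open>n\<close> times the sum of the small sequence, up to \<open>O(1/n)\<close> (\<open>conv_slow_bigo\<close>).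

  The prime polynomial theorem itself follows from \<open>(\<Sum>d dvd n. d * \<pi>\<^sub>q(d)) = q ^ n\<close>
  (\<open>sum_irreducible_degrees\<close>), proved here without extension fields by averaging
  \<open>deg f = (\<Sum>l ^ j dvd f. deg l)\<close> over all monic \<open>f\<close> of a given degree.
\<close>

section \<open>Monic polynomials and their multiples\<close>

lemma monic_poly_degree_0: "lead_coeff (f :: 'a::field poly) = 1 \<Longrightarrow> degree f = 0 \<Longrightarrow> f = 1"
  by (metis degree_0_id of_nat_1 of_nat_poly one_poly_eq_simps(1) pCons_one)

lemma card_field_ge_2: "2 \<le> CARD('a::{field,finite})"
proof -
  have "card {0, 1 :: 'a} \<le> CARD('a)"
    by (rule card_mono) auto
  thus ?thesis by simp
qed

lemma monics_of_degree_0: "(monics_of_degree 0 :: 'a::{field,finite} poly set) = {1}"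
  by (auto simp: monics_of_degree_def monic_poly_degree_0)

lemma monics_of_degree_Suc:
  "(monics_of_degree (Suc n) :: 'a::{field,finite} poly set)
     = (\<lambda>(c, f). pCons c f) ` (UNIV \<times> monics_of_degree n)"
proof (intro set_eqI iffI)
  fix f :: "'a poly" assume f: "f \<in> monics_of_degree (Suc n)"
  obtain c g where cg: "f = pCons c g" by (cases f)
  show "f \<in> (\<lambda>(c, f). pCons c f) ` (UNIV \<times> monics_of_degree n)"
    using f cg by (auto simp: monics_of_degree_def split: if_splits)
qed (auto simp: monics_of_degree_def split: if_splits)

lemma finite_card_monics_of_degree:
  "finite (monics_of_degree n :: 'a::{field,finite} poly set)
   \<and> card (monics_of_degree n :: 'a poly set) = CARD('a) ^ n"
proof (induction n)
  case 0
  show ?case by (simp add: monics_of_degree_0)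
next
  case (Suc n)
  have "inj_on (\<lambda>(c, f). pCons c f) (UNIV \<times> (monics_of_degree n :: 'a poly set))"
    by (auto simp: inj_on_def)
  with Suc show ?case
    by (simp add: monics_of_degree_Suc card_image card_cartesian_product)
qed

lemmas finite_monics_of_degree = finite_card_monics_of_degree [THEN conjunct1]
lemmas card_monics_of_degree = finite_card_monics_of_degree [THEN conjunct2]

text \<open>The proportion of the monic polynomials of degree \<open>n\<close> that are divisible by a given monic
  polynomial of degree \<open>m\<close>.  The first argument only fixes the field.\<close>

definition mdensity :: "'a::{field,finite} itself \<Rightarrow> nat \<Rightarrow> nat \<Rightarrow> real" where
  "mdensity _ n m = (if m \<le> n then 1 / real CARD('a) ^ m else 0)"

lemma card_monic_multiples:
  fixes g :: "'a::{field,finite} poly" and K :: "'a itself"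
  assumes g: "lead_coeff g = 1"
  shows "real (card {f \<in> monics_of_degree n. g dvd f}) = real CARD('a) ^ n * mdensity K n (degree g)"
proof (cases "degree g \<le> n")
  case True
  have g0: "g \<noteq> 0" using g by auto
  have "{f \<in> monics_of_degree n. g dvd f} = (*) g ` monics_of_degree (n - degree g)" (is "?A = ?B")
  proof (intro set_eqI iffI)
    fix f assume "f \<in> ?A"
    then obtain h where h: "f = g * h" and f: "lead_coeff f = 1" "degree f = n"
      by (auto simp: monics_of_degree_def)
    have h0: "h \<noteq> 0" using h f by auto
    have "lead_coeff f = lead_coeff g * lead_coeff h" by (simp only: h lead_coeff_mult)
    moreover have "degree f = degree g + degree h" using h h0 g0 by (simp add: degree_mult_eq)
    ultimately have "h \<in> monics_of_degree (n - degree g)"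
      using f g by (simp add: monics_of_degree_def)
    thus "f \<in> ?B" using h by auto
  next
    fix f assume "f \<in> ?B"
    then obtain h where hf: "f = g * h" and "h \<in> monics_of_degree (n - degree g)"
      by blast
    hence h: "f = g * h" "lead_coeff h = 1" "degree h = n - degree g"
      by (auto simp: monics_of_degree_def)
    have h0: "h \<noteq> 0" using h by auto
    have "lead_coeff f = lead_coeff g * lead_coeff h" by (simp only: h lead_coeff_mult)
    moreover have "degree f = degree g + degree h" using h h0 g0 by (simp add: degree_mult_eq)
    ultimately show "f \<in> ?A"
      using h g True by (simp add: monics_of_degree_def)
  qed
  moreover have "inj_on ((*) g) (monics_of_degree (n - degree g))"
    using g0 by (auto simp: inj_on_def)
  ultimately have "card {f \<in> monics_of_degree n. g dvd f} = CARD('a) ^ (n - degree g)"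
    by (simp add: card_image card_monics_of_degree)
  moreover have "real CARD('a) ^ (n - degree g) = real CARD('a) ^ n / real CARD('a) ^ degree g"
    using True card_field_ge_2[where 'a='a] by (intro power_diff) auto
  ultimately show ?thesis using True by (simp add: mdensity_def)
next
  case False
  have "{f \<in> monics_of_degree n. g dvd f} = {}"
    using False dvd_imp_degree_le[of g] by (fastforce simp: monics_of_degree_def)
  thus ?thesis using False by (simp add: mdensity_def del: Collect_empty_eq)
qed

lemma monic_irreducible_prime_elem: "l \<in> monic_irreducibles \<Longrightarrow> prime_elem l"
  by (auto simp: monic_irreducibles_def field_poly_irreducible_imp_prime)

lemma monic_irreducible_degree_pos: "l \<in> monic_irreducibles \<Longrightarrow> degree l > 0"
  using monic_poly_degree_0[of l]
  by (cases "degree l = 0") (auto simp: monic_irreducibles_def irreducible_def)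

lemma monic_irreducible_neq_0: "l \<in> monic_irreducibles \<Longrightarrow> l \<noteq> 0"
  using monic_irreducible_degree_pos by fastforce

lemma monic_irreducible_dvd_eq:
  assumes "l \<in> monic_irreducibles" "l' \<in> monic_irreducibles" "l dvd l'"
  shows "l = l'"
proof -
  obtain c where c: "l' = l * c" using assms by auto
  have "\<not> l dvd 1"
    using assms(1) by (auto simp: monic_irreducibles_def irreducible_not_unit)
  moreover have "irreducible l'" using assms(2) by (simp add: monic_irreducibles_def)
  ultimately have "c dvd 1" using c irreducibleD by blast
  hence "degree c = 0" using dvd_imp_degree_le[of c 1] by simp
  moreover have "lead_coeff c = 1"
    using c assms(1,2) by (auto simp: monic_irreducibles_def lead_coeff_mult)
  ultimately show ?thesis using c monic_poly_degree_0 by fastforce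
qed

lemma degree_monic_irreducible_power:
  "l \<in> monic_irreducibles \<Longrightarrow> degree (l ^ k) = k * degree l"
  by (simp add: degree_power_eq monic_irreducible_neq_0)

lemma lead_coeff_monic_irreducible_power:
  "l \<in> monic_irreducibles \<Longrightarrow> lead_coeff (l ^ k) = 1"
  by (simp add: lead_coeff_power monic_irreducibles_def)

lemma monic_irreducible_powers_dvd:
  assumes l: "l \<in> monic_irreducibles" "l' \<in> monic_irreducibles" "l \<noteq> l'"
  shows "l ^ a * l' ^ b dvd f \<longleftrightarrow> l ^ a dvd f \<and> l' ^ b dvd f"
proof
  assume "l ^ a dvd f \<and> l' ^ b dvd f"
  then obtain g where g: "f = l ^ a * g" and "l' ^ b dvd l ^ a * g" by auto
  moreover have "\<not> l' dvd l ^ a"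
    using l monic_irreducible_prime_elem prime_elem_dvd_power monic_irreducible_dvd_eq by blast
  ultimately have "l' ^ b dvd g"
    using prime_power_dvd_multD[OF monic_irreducible_prime_elem[OF l(2)], of b "l ^ a" g]
    by (cases "b = 0") simp_all
  thus "l ^ a * l' ^ b dvd f" by (simp add: g mult_dvd_mono)
next
  assume *: "l ^ a * l' ^ b dvd f"
  show "l ^ a dvd f \<and> l' ^ b dvd f"
    using dvd_mult_left[OF *] dvd_mult_right[OF *] by blast
qed

section \<open>The second moment as a sum over pairs of irreducibles\<close>

text \<open>The monic irreducibles of degree at most \<open>n\<close>; a finite set that contains every prime factor of
  a polynomial of degree \<open>n\<close>.\<close>

definition small_irreducibles :: "'a::{field,finite} itself \<Rightarrow> nat \<Rightarrow> 'a poly set" where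
  "small_irreducibles _ n = {l \<in> monic_irreducibles. degree l \<le> n}"

lemma finite_small_irreducibles: "finite (small_irreducibles K n)"
proof (rule finite_subset)
  show "small_irreducibles K n \<subseteq> (\<Union>d\<le>n. monics_of_degree d)"
    by (auto simp: small_irreducibles_def monic_irreducibles_def monics_of_degree_def)
qed (auto simp: finite_monics_of_degree)

lemma nu_eq_iff:
  assumes l: "l \<in> monic_irreducibles" and f: "f \<noteq> 0"
  shows "nu l f = k \<longleftrightarrow> l ^ k dvd f \<and> \<not> l ^ Suc k dvd f"
proof -
  let ?S = "{m. l ^ m dvd f}"
  have sub: "?S \<subseteq> {..degree f}"
  proof
    fix m assume "m \<in> ?S"
    hence "m * degree l \<le> degree f"
      using f dvd_imp_degree_le[of "l ^ m" f] by (simp add: degree_monic_irreducible_power[OF l])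
    moreover have "m * 1 \<le> m * degree l"
      using monic_irreducible_degree_pos[OF l] by (intro mult_le_mono2) auto
    ultimately have "m * 1 \<le> degree f" by (rule order.trans[rotated])
    thus "m \<in> {..degree f}" by simp
  qed
  hence fin: "finite ?S" by (rule finite_subset) auto
  have ne: "?S \<noteq> {}" using power_0[of l] one_dvd by (metis empty_iff mem_Collect_eq)
  have down: "l ^ i dvd f" if "l ^ j dvd f" "i \<le> j" for i j
    using that by (meson dvd_trans le_imp_power_dvd)
  show ?thesis
  proof
    assume "nu l f = k"
    hence k: "Max ?S = k" by (simp add: nu_def)
    hence "k \<in> ?S" using Max_in[OF fin ne] by simp
    moreover have "Suc k \<notin> ?S" using Max_ge[OF fin, of "Suc k"] k by auto
    ultimately show "l ^ k dvd f \<and> \<not> l ^ Suc k dvd f" by simp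
  next
    assume *: "l ^ k dvd f \<and> \<not> l ^ Suc k dvd f"
    have "Max ?S = k"
    proof (rule Max_eqI[OF fin])
      fix y assume "y \<in> ?S"
      thus "y \<le> k" using * down[of y "Suc k"] by (meson mem_Collect_eq not_less_eq_eq)
    qed (use * in auto)
    thus "nu l f = k" by (simp add: nu_def)
  qed
qed

text \<open>For \<open>k = 0\<close> the sum would miss the irreducibles of degree greater than \<open>n\<close>.\<close>

lemma omega_conv_sum:
  fixes K :: "'a::{field,finite} itself" and f :: "'a poly"
  assumes "k \<ge> 1" and f: "f \<in> monics_of_degree n"
  shows "real (omega k f)
    = (\<Sum>l\<in>small_irreducibles K n. of_bool (l ^ k dvd f) - of_bool (l ^ Suc k dvd f))"
proof -
  have f0: "f \<noteq> 0" and deg: "degree f = n" using f by (auto simp: monics_of_degree_def)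
  have "degree l \<le> n" if "l \<in> monic_irreducibles" "l ^ k dvd f" for l :: "'a poly"
    using that assms(1) dvd_imp_degree_le[of l f] f0 deg
    by (metis One_nat_def Suc_le_eq dvd_power dvd_trans)
  hence "{l \<in> monic_irreducibles. nu l f = k}
      = {l \<in> small_irreducibles K n. l ^ k dvd f \<and> \<not> l ^ Suc k dvd f}"
    using nu_eq_iff f0 by (auto simp: small_irreducibles_def)
  hence "real (omega k f)
      = (\<Sum>l\<in>small_irreducibles K n. of_bool (l ^ k dvd f \<and> \<not> l ^ Suc k dvd f))"
    by (simp add: omega_def finite_small_irreducibles sum.If_cases of_bool_def Int_def)
  also have "\<dots> = (\<Sum>l\<in>small_irreducibles K n. of_bool (l ^ k dvd f) - of_bool (l ^ Suc k dvd f))"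
    by (rule sum.cong) (auto dest: dvd_mult_right)
  finally show ?thesis .
qed

lemma sum_of_bool_dvd:
  fixes g :: "'a::{field,finite} poly" and K :: "'a itself"
  assumes "lead_coeff g = 1"
  shows "(\<Sum>f\<in>monics_of_degree n. of_bool (g dvd f)) = real CARD('a) ^ n * mdensity K n (degree g)"
  using card_monic_multiples[OF assms, where n=n and K=K]
  by (simp add: finite_monics_of_degree sum.If_cases of_bool_def Int_def)

text \<open>Squaring \<open>omega k f\<close> produces a sum over pairs of irreducibles.  For \<open>l \<noteq> l'\<close> the conditions on
  \<open>l\<close> and \<open>l'\<close> combine to divisibility by products of their powers, which gives \<open>G\<close>; on the diagonal,
  an indicator is its own square.  The first double sum includes the diagonal, the second sum
  corrects it.\<close>

lemma sum_omega_sq_mdensity: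
  fixes K :: "'a::{field,finite} itself" and n :: nat
  assumes k: "k \<ge> 1"
  defines "q \<equiv> real CARD('a)" and "P \<equiv> small_irreducibles K n"
  defines "G \<equiv> \<lambda>d d'. mdensity K n (k * d + k * d') - mdensity K n (k * d + Suc k * d')
                     - mdensity K n (Suc k * d + k * d') + mdensity K n (Suc k * d + Suc k * d')"
  shows "(\<Sum>f\<in>(monics_of_degree n :: 'a poly set). (real (omega k f))\<^sup>2)
    = q ^ n * ((\<Sum>l\<in>P. \<Sum>l'\<in>P. G (degree l) (degree l'))
             + (\<Sum>l\<in>P. mdensity K n (k * degree l) - mdensity K n (Suc k * degree l)
                        - G (degree l) (degree l)))"
proof -
  let ?\<delta> = "\<lambda>f l. of_bool (l ^ k dvd f) - of_bool (l ^ Suc k dvd f) :: real"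
  let ?M = "monics_of_degree n :: 'a poly set"
  have Pm: "l \<in> monic_irreducibles" if "l \<in> P" for l
    using that by (simp add: P_def small_irreducibles_def)
  have finP: "finite P" by (simp add: P_def finite_small_irreducibles)
  have off: "(\<Sum>f\<in>?M. ?\<delta> f l * ?\<delta> f l') = q ^ n * G (degree l) (degree l')"
    if l: "l \<in> P" "l' \<in> P" "l \<noteq> l'" for l l'
  proof -
    have *: "(\<Sum>f\<in>?M. of_bool (l ^ a dvd f) * of_bool (l' ^ b dvd f))
        = q ^ n * mdensity K n (a * degree l + b * degree l')" for a b
    proof -
      have "(\<Sum>f\<in>?M. of_bool (l ^ a dvd f) * of_bool (l' ^ b dvd f))
          = (\<Sum>f\<in>?M. of_bool (l ^ a * l' ^ b dvd f) :: real)"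
        by (rule sum.cong) (auto simp: monic_irreducible_powers_dvd[OF Pm[OF l(1)] Pm[OF l(2)] l(3)])
      also have "\<dots> = q ^ n * mdensity K n (degree (l ^ a * l' ^ b))"
        unfolding q_def
        by (rule sum_of_bool_dvd)
           (simp add: lead_coeff_mult lead_coeff_monic_irreducible_power Pm l del: lead_coeff_power)
      also have "degree (l ^ a * l' ^ b) = a * degree l + b * degree l'"
        using l Pm by (simp add: degree_mult_eq degree_monic_irreducible_power monic_irreducible_neq_0)
      finally show ?thesis .
    qed
    have "(\<Sum>f\<in>?M. ?\<delta> f l * ?\<delta> f l')
       = (\<Sum>f\<in>?M. of_bool (l ^ k dvd f) * of_bool (l' ^ k dvd f))
       - (\<Sum>f\<in>?M. of_bool (l ^ k dvd f) * of_bool (l' ^ Suc k dvd f))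
       - (\<Sum>f\<in>?M. of_bool (l ^ Suc k dvd f) * of_bool (l' ^ k dvd f))
       + (\<Sum>f\<in>?M. of_bool (l ^ Suc k dvd f) * of_bool (l' ^ Suc k dvd f))"
      unfolding sum_subtractf[symmetric] sum.distrib[symmetric]
      by (rule sum.cong) (auto simp: algebra_simps)
    also have "\<dots> = q ^ n * G (degree l) (degree l')"
      unfolding * G_def by (simp only: algebra_simps)
    finally show ?thesis .
  qed
  have diag: "(\<Sum>f\<in>?M. ?\<delta> f l * ?\<delta> f l)
      = q ^ n * (mdensity K n (k * degree l) - mdensity K n (Suc k * degree l))"
    if l: "l \<in> P" for l
  proof -
    have "(\<Sum>f\<in>?M. ?\<delta> f l * ?\<delta> f l) = (\<Sum>f\<in>?M. ?\<delta> f l)"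
      by (rule sum.cong) (auto dest: dvd_mult_right)
    also have "\<dots> = q ^ n * mdensity K n (degree (l ^ k)) - q ^ n * mdensity K n (degree (l ^ Suc k))"
      unfolding sum_subtractf q_def
      using lead_coeff_monic_irreducible_power[OF Pm[OF l]] by (simp only: sum_of_bool_dvd[where K=K])
    finally show ?thesis
      by (simp only: degree_monic_irreducible_power[OF Pm[OF l]] right_diff_distrib)
  qed
  have "(\<Sum>f\<in>?M. (real (omega k f))\<^sup>2) = (\<Sum>f\<in>?M. \<Sum>l\<in>P. \<Sum>l'\<in>P. ?\<delta> f l * ?\<delta> f l')"
    using omega_conv_sum[OF k, where n=n and K=K]
    by (intro sum.cong) (auto simp: power2_eq_square sum_product P_def simp del: power_Suc)
  also have "\<dots> = (\<Sum>l\<in>P. \<Sum>f\<in>?M. \<Sum>l'\<in>P. ?\<delta> f l * ?\<delta> f l')"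
    by (rule sum.swap)
  also have "\<dots> = (\<Sum>l\<in>P. \<Sum>l'\<in>P. \<Sum>f\<in>?M. ?\<delta> f l * ?\<delta> f l')"
    by (rule sum.cong[OF refl], rule sum.swap)
  also have "\<dots> = (\<Sum>l\<in>P. \<Sum>l'\<in>P. q ^ n * G (degree l) (degree l')
      + (if l' = l then q ^ n * (mdensity K n (k * degree l) - mdensity K n (Suc k * degree l)
                        - G (degree l) (degree l)) else 0))"
  proof (intro sum.cong refl, goal_cases)
    case (1 l l')
    show ?case
    proof (cases "l' = l")
      case True
      show ?thesis unfolding True diag[OF 1(1)] if_P[OF refl] by (simp only: right_diff_distrib)
    next
      case False
      thus ?thesis using off[OF 1] by simp
    qed
  qed
  also have "\<dots> = q ^ n * ((\<Sum>l\<in>P. \<Sum>l'\<in>P. G (degree l) (degree l'))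
             + (\<Sum>l\<in>P. mdensity K n (k * degree l) - mdensity K n (Suc k * degree l)
                        - G (degree l) (degree l)))"
    by (simp add: sum.distrib finP sum_distrib_left distrib_left)
  finally show ?thesis .
qed

text \<open>The part of the series \<open>L K m\<close> that comes from the irreducibles \<open>l\<close> with \<open>\<bar>l\<bar> ^ m = q ^ j\<close>.
  Indexing by \<open>j\<close> rather than by the degree of \<open>l\<close> makes the sums over pairs with different exponents ordinary
  convolutions.\<close>

definition L_coeff :: "'a::{field,finite} itself \<Rightarrow> nat \<Rightarrow> nat \<Rightarrow> real" where
  "L_coeff _ m j = real (card {l \<in> (monic_irreducibles :: 'a poly set). m * degree l = j})
                   / real CARD('a) ^ j"

lemma L_coeff_conv_sum:
  fixes K :: "'a::{field,finite} itself"
  assumes "m \<ge> 1" "j \<le> n"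
  shows "L_coeff K m j
    = (\<Sum>l\<in>small_irreducibles K n. of_bool (m * degree l = j) / real CARD('a) ^ j)"
proof -
  have "degree l \<le> n" if "m * degree l = j" for l :: "'a poly"
  proof -
    have "1 * degree l \<le> m * degree l" using assms by (intro mult_le_mono1) auto
    thus ?thesis using that assms by simp
  qed
  hence "{l \<in> (monic_irreducibles :: 'a poly set). m * degree l = j}
        = {l \<in> small_irreducibles K n. m * degree l = j}"
    by (auto simp: small_irreducibles_def)
  thus ?thesis
    by (simp add: L_coeff_def finite_small_irreducibles sum.If_cases of_bool_def Int_def
        flip: sum_divide_distrib)
qed

lemma sum_mdensity_single:
  fixes K :: "'a::{field,finite} itself"
  assumes "m \<ge> 1"
  shows "(\<Sum>l\<in>small_irreducibles K n. mdensity K n (m * degree l)) = (\<Sum>j\<le>n. L_coeff K m j)"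
proof -
  have "(\<Sum>j\<le>n. L_coeff K m j)
     = (\<Sum>j\<le>n. \<Sum>l\<in>small_irreducibles K n. of_bool (m * degree l = j) / real CARD('a) ^ j)"
    using assms by (intro sum.cong refl L_coeff_conv_sum) auto
  also have "\<dots> = (\<Sum>l\<in>small_irreducibles K n. \<Sum>j\<le>n.
                     if m * degree l = j then 1 / real CARD('a) ^ j else 0)"
    by (subst sum.swap) (intro sum.cong refl, simp)
  also have "\<dots> = (\<Sum>l\<in>small_irreducibles K n. mdensity K n (m * degree l))"
    by (simp add: sum.delta' mdensity_def)
  finally show ?thesis ..
qed

lemma sum_mdensity_pair:
  fixes K :: "'a::{field,finite} itself"
  assumes "a \<ge> 1" "b \<ge> 1"
  shows "(\<Sum>l\<in>small_irreducibles K n. \<Sum>l'\<in>small_irreducibles K n.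
            mdensity K n (a * degree l + b * degree l'))
    = (\<Sum>s\<le>n. \<Sum>i\<le>s. L_coeff K a i * L_coeff K b (s - i))"
proof -
  let ?P = "small_irreducibles K n" and ?q = "real CARD('a)"
  have eq: "mdensity K n (x + y)
      = (\<Sum>s\<le>n. \<Sum>i\<le>s. (of_bool (x = i) / ?q ^ i) * (of_bool (y = s - i) / ?q ^ (s - i)))"
    for x y
  proof -
    have "(\<Sum>i\<le>s. (of_bool (x = i) / ?q ^ i) * (of_bool (y = s - i) / ?q ^ (s - i)))
        = (if x + y = s then 1 / ?q ^ s else 0)" for s
    proof -
      have "(\<Sum>i\<le>s. (of_bool (x = i) / ?q ^ i) * (of_bool (y = s - i) / ?q ^ (s - i)))
          = (\<Sum>i\<le>s. if x = i then (of_bool (y = s - i) / (?q ^ i * ?q ^ (s - i))) else 0)"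
        by (intro sum.cong) auto
      moreover have "?q ^ x * ?q ^ (s - x) = ?q ^ s" if "x \<le> s"
        using that by (simp flip: power_add)
      ultimately show ?thesis by auto
    qed
    thus ?thesis by (simp add: mdensity_def sum.delta')
  qed
  have swap: "(\<Sum>x\<in>A. \<Sum>l\<in>?P. \<Sum>l'\<in>?P. h x l l') = (\<Sum>l\<in>?P. \<Sum>l'\<in>?P. \<Sum>x\<in>A. h x l l')"
    for A :: "nat set" and h :: "nat \<Rightarrow> 'a poly \<Rightarrow> 'a poly \<Rightarrow> real"
    by (subst sum.swap, intro sum.cong refl, rule sum.swap)
  have "(\<Sum>s\<le>n. \<Sum>i\<le>s. L_coeff K a i * L_coeff K b (s - i))
     = (\<Sum>s\<le>n. \<Sum>i\<le>s. \<Sum>l\<in>?P. \<Sum>l'\<in>?P. (of_bool (a * degree l = i) / ?q ^ i)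
                              * (of_bool (b * degree l' = s - i) / ?q ^ (s - i)))"
    using assms
    by (intro sum.cong refl) (subst (1 2) L_coeff_conv_sum[where n=n], auto simp: sum_product)
  also have "\<dots> = (\<Sum>l\<in>?P. \<Sum>l'\<in>?P. \<Sum>s\<le>n. \<Sum>i\<le>s. (of_bool (a * degree l = i) / ?q ^ i)
                              * (of_bool (b * degree l' = s - i) / ?q ^ (s - i)))"
    by (simp only: swap)
  finally show ?thesis by (simp only: eq)
qed

text \<open>Partial sums of the series for \<open>L K m\<close> and of the Cauchy product of two such series.  They
  diverge if one of the exponents is \<open>1\<close>.\<close>

definition L_partial :: "'a::{field,finite} itself \<Rightarrow> nat \<Rightarrow> nat \<Rightarrow> real" where
  "L_partial K m n = (\<Sum>j\<le>n. L_coeff K m j)"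

definition L_conv :: "'a::{field,finite} itself \<Rightarrow> nat \<Rightarrow> nat \<Rightarrow> nat \<Rightarrow> real" where
  "L_conv K a b n = (\<Sum>s\<le>n. \<Sum>i\<le>s. L_coeff K a i * L_coeff K b (s - i))"

lemma L_conv_commute: "L_conv K a b n = L_conv K b a n"
  unfolding L_conv_def
proof (rule sum.cong[OF refl])
  fix s
  show "(\<Sum>i\<le>s. L_coeff K a i * L_coeff K b (s - i)) = (\<Sum>i\<le>s. L_coeff K b i * L_coeff K a (s - i))"
    by (rule sum.reindex_bij_witness[of _ "\<lambda>i. s - i" "\<lambda>i. s - i"]) (auto simp: mult.commute)
qed

lemma sum_omega_sq_eq:
  fixes K :: "'a::{field,finite} itself"
  assumes k: "k \<ge> 1"
  shows "(\<Sum>f\<in>(monics_of_degree n :: 'a poly set). (real (omega k f))\<^sup>2)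
    = real CARD('a) ^ n *
      (L_partial K k n - L_partial K (k + 1) n
       + L_conv K k k n - 2 * L_conv K k (k + 1) n + L_conv K (k + 1) (k + 1) n
       - L_partial K (2 * k) n + 2 * L_partial K (2 * k + 1) n - L_partial K (2 * k + 2) n)"
proof -
  let ?P = "small_irreducibles K n"
  have D: "(\<Sum>l\<in>?P. mdensity K n (a * degree l + b * degree l)) = L_partial K (a + b) n"
    if "a \<ge> 1" for a b
    using sum_mdensity_single[of "a + b" K n] that by (simp add: L_partial_def algebra_simps)
  have D1: "(\<Sum>l\<in>?P. mdensity K n (a * degree l)) = L_partial K a n" if "a \<ge> 1" for a
    using sum_mdensity_single[of a K n] that by (simp add: L_partial_def)
  have T: "(\<Sum>l\<in>?P. \<Sum>l'\<in>?P. mdensity K n (a * degree l + b * degree l')) = L_conv K a b n"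
    if "a \<ge> 1" "b \<ge> 1" for a b
    using sum_mdensity_pair[OF that] by (simp add: L_conv_def)
  have d: "(\<Sum>l\<in>?P. mdensity K n (k * degree l + k * degree l)) = L_partial K (2 * k) n"
          "(\<Sum>l\<in>?P. mdensity K n (k * degree l + Suc k * degree l)) = L_partial K (2 * k + 1) n"
          "(\<Sum>l\<in>?P. mdensity K n (Suc k * degree l + k * degree l)) = L_partial K (2 * k + 1) n"
          "(\<Sum>l\<in>?P. mdensity K n (Suc k * degree l + Suc k * degree l)) = L_partial K (2 * k + 2) n"
    using k D[of k k] D[of k "Suc k"] D[of "Suc k" k] D[of "Suc k" "Suc k"]
    by (simp_all only: mult_2 add_Suc_right add_Suc One_nat_def add_0_right numeral_2_eq_2) simp_all
  have k': "Suc k \<ge> 1" by simp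
  show ?thesis
    unfolding sum_omega_sq_mdensity[OF k, of n K] sum.distrib sum_subtractf d
      D1[OF k] D1[OF k'] T[OF k k] T[OF k k'] T[OF k' k] T[OF k' k'] L_conv_commute[of K "Suc k" k n]
    by simp
qed

section \<open>The number of irreducible polynomials of a given degree\<close>

lemma exists_monic_irreducible_dvd:
  "degree (f :: 'a::{field,finite} poly) > 0 \<Longrightarrow> \<exists>l\<in>monic_irreducibles. l dvd f"
proof (induction "degree f" arbitrary: f rule: less_induct)
  case less
  have f0: "f \<noteq> 0" and nu: "\<not> f dvd 1"
    using less.prems dvd_imp_degree_le[of f 1] by auto
  show ?case
  proof (cases "irreducible f")
    case True
    define c where "c = inverse (lead_coeff f)"
    have c: "c \<noteq> 0" using f0 by (simp add: c_def)
    have "[:c:] dvd 1" using c by (simp add: is_unit_iff_degree)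
    hence "irreducible ([:c:] * f)" using True irreducible_mult_unit_left by blast
    moreover have "lead_coeff ([:c:] * f) = 1" using f0 by (simp add: c_def)
    ultimately have "[:c:] * f \<in> monic_irreducibles" by (simp add: monic_irreducibles_def)
    moreover have "[:c:] * f dvd f" using c by (simp add: smult_dvd_iff)
    ultimately show ?thesis by blast
  next
    case False
    then obtain a b where ab: "f = a * b" "\<not> a dvd 1" "\<not> b dvd 1"
      using f0 nu by (auto simp: irreducible_def)
    hence nz: "a \<noteq> 0" "b \<noteq> 0" using f0 by auto
    hence "degree a > 0" "degree b > 0" using ab by (auto simp: is_unit_iff_degree)
    moreover from this have "degree a < degree f" using ab nz by (simp add: degree_mult_eq)
    ultimately obtain l where "l \<in> monic_irreducibles" "l dvd a" using less.hyps by blast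
    thus ?thesis using ab(1) dvd_mult2 by blast
  qed
qed

text \<open>Unique factorisation, seen through degrees: \<open>degree f\<close> is the sum of \<open>degree l\<close> over all
  prime powers \<open>l ^ j\<close>, \<open>j \<ge> 1\<close>, that divide \<open>f\<close>.\<close>

lemma degree_conv_sum_prime_powers:
  fixes K :: "'a::{field,finite} itself" and f :: "'a poly"
  assumes "lead_coeff f = 1" "degree f \<le> N"
  shows "degree f = (\<Sum>l\<in>small_irreducibles K N. \<Sum>j=1..N. of_bool (l ^ j dvd f) * degree l)"
  using assms
proof (induction "degree f" arbitrary: f rule: less_induct)
  case less
  show ?case
  proof (cases "degree f = 0")
    case True
    hence f: "f = 1" using less.prems monic_poly_degree_0 by blast
    have "\<not> l ^ j dvd 1" if "l \<in> small_irreducibles K N" "j \<in> {1..N}" for l and j :: nat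
      using that by (auto simp: small_irreducibles_def monic_irreducibles_def is_unit_power_iff
          irreducible_def)
    thus ?thesis by (simp add: f)
  next
    case False
    then obtain p g where p: "p \<in> monic_irreducibles" and f: "f = p * g"
      using exists_monic_irreducible_dvd[of f] by (auto elim!: dvdE)
    have g0: "g \<noteq> 0" and f0: "f \<noteq> 0" using False f by auto
    have "lead_coeff f = lead_coeff p * lead_coeff g" by (simp only: f lead_coeff_mult)
    hence g1: "lead_coeff g = 1" using p less.prems by (simp add: monic_irreducibles_def)
    have deg: "degree f = degree p + degree g"
      using f g0 monic_irreducible_neq_0[OF p] by (simp add: degree_mult_eq)
    note dp = monic_irreducible_degree_pos[OF p]
    \<comment> \<open>Splitting off \<open>p\<close> shifts the exponents of \<open>p\<close> by one and leaves those of the other primes.\<close>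
    have step: "(\<Sum>j=1..N. of_bool (l ^ j dvd f) * degree l)
        = (\<Sum>j=1..N. of_bool (l ^ j dvd g) * degree l) + (if l = p then degree p else 0)"
      if l: "l \<in> small_irreducibles K N" for l
    proof (cases "l = p")
      case True
      have "\<not> p ^ N dvd g"
      proof
        assume "p ^ N dvd g"
        hence "N * degree p \<le> degree g"
          using dvd_imp_degree_le[of "p ^ N" g] g0 degree_monic_irreducible_power[OF p] by simp
        moreover have "N * 1 \<le> N * degree p" using dp by (intro mult_le_mono2) auto
        ultimately show False using deg dp less.prems by linarith
      qed
      moreover have "(\<Sum>j<Suc N. of_bool (p ^ j dvd g) :: nat) = 1 + (\<Sum>j<N. of_bool (p ^ Suc j dvd g))"
        by (simp only: sum.lessThan_Suc_shift) simp
      ultimately have *: "(\<Sum>j<N. of_bool (p ^ j dvd g) :: nat) = 1 + (\<Sum>j<N. of_bool (p ^ Suc j dvd g))"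
        by simp
      have "(\<Sum>j=1..N. of_bool (p ^ j dvd f)) = (\<Sum>j<N. of_bool (p ^ j dvd g) :: nat)"
        using monic_irreducible_neq_0[OF p] by (simp add: sum.atLeast1_atMost_eq f)
      also have "\<dots> = 1 + (\<Sum>j=1..N. of_bool (p ^ j dvd g))"
        by (simp only: * sum.atLeast1_atMost_eq One_nat_def)
      finally show ?thesis using True by (simp flip: sum_distrib_right)
    next
      case False
      have lm: "l \<in> monic_irreducibles" using l by (simp add: small_irreducibles_def)
      have "\<not> l dvd p" using monic_irreducible_dvd_eq[OF lm p] False by blast
      hence "l ^ j dvd f \<longleftrightarrow> l ^ j dvd g" if "j > 0" for j
        using prime_power_dvd_multD[OF monic_irreducible_prime_elem[OF lm], of j p g] that f
        by (metis dvd_mult)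
      thus ?thesis using False by simp
    qed
    have pN: "p \<in> small_irreducibles K N" using p deg less.prems by (simp add: small_irreducibles_def)
    have "degree g = (\<Sum>l\<in>small_irreducibles K N. \<Sum>j=1..N. of_bool (l ^ j dvd g) * degree l)"
      by (rule less.hyps) (use deg dp g1 less.prems in auto)
    moreover have "(\<Sum>l\<in>small_irreducibles K N. \<Sum>j=1..N. of_bool (l ^ j dvd f) * degree l)
        = (\<Sum>l\<in>small_irreducibles K N. (\<Sum>j=1..N. of_bool (l ^ j dvd g) * degree l)
             + (if l = p then degree p else 0))"
      by (rule sum.cong[OF refl step])
    moreover have "(\<Sum>l\<in>small_irreducibles K N. if l = p then degree p else 0) = degree p"
      using pN by (simp add: finite_small_irreducibles)
    ultimately show ?thesis using deg by (simp only: sum.distrib add.commute)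
  qed
qed

lemma sum_dvd_degree:
  fixes d s n :: nat
  assumes "d > 0" "s \<in> {1..n}"
  shows "(\<Sum>j=1..n. of_bool (j * d = s)) = (of_bool (d dvd s) :: real)"
proof (cases "d dvd s")
  case True
  then obtain c where c: "s = d * c" by auto
  have "c \<in> {1..n}"
  proof -
    have "1 * c \<le> d * c" by (rule mult_le_mono1) (use assms(1) in linarith)
    hence "c \<le> s" by (simp only: c mult_1)
    hence "c \<le> n" using assms(2) by simp
    thus ?thesis using assms c by (cases "c = 0") auto
  qed
  moreover have "j * d = s \<longleftrightarrow> j = c" for j using c assms by auto
  ultimately show ?thesis using True by simp
next
  case False
  hence "j * d \<noteq> s" for j by auto
  thus ?thesis using False by simp
qed

text \<open>Gauss's identity \<open>(\<Sum>d dvd n. d * \<pi>\<^sub>q(d)) = q ^ n\<close>.  Averaging the degree over all monic polynomials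
  of degree \<open>m\<close> by means of \<open>degree_conv_sum_prime_powers\<close> gives \<open>m = (\<Sum>s=1..m. \<Lambda> s / q ^ s)\<close>, where \<open>\<Lambda> s\<close> is the
  left-hand side of the identity at \<open>s\<close>; taking the difference of consecutive \<open>m\<close> isolates \<open>\<Lambda> n\<close>.\<close>

lemma sum_irreducible_degrees:
  fixes K :: "'a::{field,finite} itself"
  assumes n: "n > 0"
  shows "(\<Sum>l\<in>small_irreducibles K n. of_bool (degree l dvd n) * real (degree l))
    = real CARD('a) ^ n"
proof -
  let ?q = "real CARD('a)"
  define \<Lambda> where "\<Lambda> s = (\<Sum>l\<in>small_irreducibles K s. of_bool (degree l dvd s) * real (degree l))" for s
  have q: "?q > 0" by simp
  have dpos: "degree l > 0" if "l \<in> small_irreducibles K m" for l m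
    using that monic_irreducible_degree_pos by (auto simp: small_irreducibles_def)
  have \<Lambda>: "\<Lambda> s = (\<Sum>l\<in>small_irreducibles K m. of_bool (degree l dvd s) * real (degree l))"
    if "s \<in> {1..m}" for s m
    unfolding \<Lambda>_def using that
    by (intro sum.mono_neutral_left finite_small_irreducibles)
       (auto simp: small_irreducibles_def dest: dvd_imp_le)
  have summatory: "real m = (\<Sum>s=1..m. \<Lambda> s / ?q ^ s)" for m
  proof -
    have "?q ^ m * real m = (\<Sum>f\<in>(monics_of_degree m :: 'a poly set). real (degree f))"
      by (simp add: monics_of_degree_def card_monics_of_degree[unfolded monics_of_degree_def])
    also have "\<dots> = (\<Sum>f\<in>monics_of_degree m.
        \<Sum>l\<in>small_irreducibles K m. \<Sum>j=1..m. real (degree l) * of_bool (l ^ j dvd f))"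
    proof (rule sum.cong[OF refl])
      fix f :: "'a poly" assume "f \<in> monics_of_degree m"
      hence "degree f = (\<Sum>l\<in>small_irreducibles K m. \<Sum>j=1..m. of_bool (l ^ j dvd f) * degree l)"
        by (intro degree_conv_sum_prime_powers) (auto simp: monics_of_degree_def)
      thus "real (degree f)
          = (\<Sum>l\<in>small_irreducibles K m. \<Sum>j=1..m. real (degree l) * of_bool (l ^ j dvd f))"
        by (simp add: mult.commute)
    qed
    also have "\<dots> = (\<Sum>l\<in>small_irreducibles K m. \<Sum>f\<in>monics_of_degree m.
        \<Sum>j=1..m. real (degree l) * of_bool (l ^ j dvd f))"
      by (rule sum.swap)
    also have "\<dots> = (\<Sum>l\<in>small_irreducibles K m. \<Sum>j=1..m.
        \<Sum>f\<in>monics_of_degree m. real (degree l) * of_bool (l ^ j dvd f))"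
      by (rule sum.cong[OF refl], rule sum.swap)
    also have "\<dots> = (\<Sum>l\<in>small_irreducibles K m. \<Sum>j=1..m.
        real (degree l) * (?q ^ m * mdensity K m (j * degree l)))"
    proof (intro sum.cong refl)
      fix l :: "'a poly" and j assume "l \<in> small_irreducibles K m"
      hence l: "l \<in> monic_irreducibles" by (simp add: small_irreducibles_def)
      show "(\<Sum>f\<in>monics_of_degree m. real (degree l) * of_bool (l ^ j dvd f))
          = real (degree l) * (?q ^ m * mdensity K m (j * degree l))"
        using sum_of_bool_dvd[OF lead_coeff_monic_irreducible_power[OF l], where n=m and K=K, of j]
        by (simp only: sum_distrib_left[symmetric] degree_monic_irreducible_power[OF l])
    qed
    also have "\<dots> = ?q ^ m * (\<Sum>l\<in>small_irreducibles K m. \<Sum>j=1..m.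
        real (degree l) * mdensity K m (j * degree l))"
      by (simp add: sum_distrib_left mult_ac)
    finally have "real m = (\<Sum>l\<in>small_irreducibles K m. \<Sum>j=1..m.
        real (degree l) * mdensity K m (j * degree l))"
      using q by simp
    also have "\<dots> = (\<Sum>l\<in>small_irreducibles K m. \<Sum>j=1..m. \<Sum>s=1..m.
        real (degree l) * of_bool (j * degree l = s) / ?q ^ s)"
    proof (intro sum.cong refl)
      fix l :: "'a poly" and j assume l: "l \<in> small_irreducibles K m" and j: "j \<in> {1..m}"
      have "j * degree l \<ge> 1" using dpos[OF l] j by simp
      moreover have "(\<Sum>s=1..m. real (degree l) * of_bool (j * degree l = s) / ?q ^ s)
          = (\<Sum>s=1..m. if j * degree l = s then real (degree l) / ?q ^ s else 0)"
        by (rule sum.cong) auto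
      ultimately show "real (degree l) * mdensity K m (j * degree l)
          = (\<Sum>s=1..m. real (degree l) * of_bool (j * degree l = s) / ?q ^ s)"
        by (simp add: mdensity_def)
    qed
    also have "\<dots> = (\<Sum>l\<in>small_irreducibles K m. \<Sum>s=1..m. \<Sum>j=1..m.
        real (degree l) * of_bool (j * degree l = s) / ?q ^ s)"
      by (rule sum.cong[OF refl], rule sum.swap)
    also have "\<dots> = (\<Sum>l\<in>small_irreducibles K m. \<Sum>s=1..m.
        real (degree l) * of_bool (degree l dvd s) / ?q ^ s)"
      by (intro sum.cong refl)
         (simp only: sum_divide_distrib[symmetric] sum_distrib_left[symmetric] sum_dvd_degree[OF dpos])
    also have "\<dots> = (\<Sum>s=1..m. \<Sum>l\<in>small_irreducibles K m.
        real (degree l) * of_bool (degree l dvd s) / ?q ^ s)"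
      by (rule sum.swap)
    also have "\<dots> = (\<Sum>s=1..m. \<Lambda> s / ?q ^ s)"
      by (rule sum.cong[OF refl], subst \<Lambda>, assumption) (simp add: sum_divide_distrib mult_ac)
    finally show ?thesis .
  qed
  obtain m where m: "n = Suc m" using n by (cases n) auto
  have "(\<Sum>s=1..n. \<Lambda> s / ?q ^ s) = (\<Sum>s=1..m. \<Lambda> s / ?q ^ s) + \<Lambda> n / ?q ^ n"
    by (simp add: m)
  hence "real n - real m = \<Lambda> n / ?q ^ n"
    using summatory[of n] summatory[of m] by linarith
  moreover have "real n = real m + 1" by (simp add: m)
  ultimately have "\<Lambda> n / ?q ^ n = 1" by linarith
  hence "\<Lambda> n = ?q ^ n" using q by (simp add: divide_eq_1_iff)
  thus ?thesis by (simp add: \<Lambda>_def)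
qed

lemma sum_small_irreducibles_degree:
  fixes K :: "'a::{field,finite} itself" and g :: "nat \<Rightarrow> real"
  shows "(\<Sum>l\<in>small_irreducibles K n. g (degree l)) = (\<Sum>d=1..n. real (irreducible_count K d) * g d)"
proof -
  have "(\<Sum>l\<in>small_irreducibles K n. g (degree l))
      = (\<Sum>d=1..n. \<Sum>l\<in>{l \<in> small_irreducibles K n. degree l = d}. g (degree l))"
    by (rule sum.group[symmetric])
       (use finite_small_irreducibles[of K n] in \<open>auto simp: small_irreducibles_def Suc_le_eq
          monic_irreducible_degree_pos\<close>)
  also have "\<dots> = (\<Sum>d=1..n. real (irreducible_count K d) * g d)"
  proof (rule sum.cong[OF refl])
    fix d assume "d \<in> {1..n}"
    hence "{l \<in> small_irreducibles K n. degree l = d} = {l \<in> monic_irreducibles. degree l = d}"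
      by (auto simp: small_irreducibles_def)
    thus "(\<Sum>l\<in>{l \<in> small_irreducibles K n. degree l = d}. g (degree l))
        = real (irreducible_count K d) * g d"
      by (simp add: irreducible_count_def)
  qed
  finally show ?thesis .
qed

lemma sum_power_le: "(q::real) \<ge> 2 \<Longrightarrow> (\<Sum>d=1..m. q ^ d) \<le> 2 * q ^ m"
proof (induction m)
  case (Suc m)
  have "2 * q ^ m \<le> q * q ^ m" using Suc.prems by (intro mult_right_mono) auto
  moreover have "(\<Sum>d=1..Suc m. q ^ d) = (\<Sum>d=1..m. q ^ d) + q * q ^ m" by simp
  ultimately show ?case using Suc.IH[OF Suc.prems] unfolding power_Suc by linarith
qed auto

text \<open>All proper divisors of \<open>n\<close> are at most \<open>n div 2\<close>, hence the size of the error.\<close>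

lemma irreducible_count_bounds:
  fixes K :: "'a::{field,finite} itself"
  assumes n: "n > 0"
  shows irreducible_count_upper: "real (irreducible_count K n) * real n \<le> real CARD('a) ^ n"
    and irreducible_count_lower:
      "real CARD('a) ^ n - real (irreducible_count K n) * real n \<le> 2 * real CARD('a) ^ (n div 2)"
proof -
  let ?q = "real CARD('a)"
  have q2: "?q \<ge> 2" using card_field_ge_2[where 'a='a] by simp
  have eq: "?q ^ m = (\<Sum>d=1..m. real (irreducible_count K d) * (of_bool (d dvd m) * real d))"
    if "m > 0" for m
    using sum_irreducible_degrees[OF that, of K]
      sum_small_irreducibles_degree[of "\<lambda>d. of_bool (d dvd m) * real d" K m] by simp
  have upper: "real (irreducible_count K m) * real m \<le> ?q ^ m" if "m > 0" for m
  proof -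
    have "real (irreducible_count K m) * (of_bool (m dvd m) * real m) \<le> ?q ^ m"
      unfolding eq[OF that] using that by (intro member_le_sum) auto
    thus ?thesis by simp
  qed
  show "real (irreducible_count K n) * real n \<le> ?q ^ n" by (rule upper[OF n])
  obtain m where m: "n = Suc m" using n by (cases n) auto
  have "?q ^ n - real (irreducible_count K n) * real n
      = (\<Sum>d=1..m. real (irreducible_count K d) * (of_bool (d dvd n) * real d))"
    using eq[OF n] by (simp add: m)
  also have "\<dots> = (\<Sum>d=1..n div 2. real (irreducible_count K d) * (of_bool (d dvd n) * real d))"
  proof (rule sum.mono_neutral_right)
    show "\<forall>d\<in>{1..m} - {1..n div 2}. real (irreducible_count K d) * (of_bool (d dvd n) * real d) = 0"
    proof
      fix d assume d: "d \<in> {1..m} - {1..n div 2}"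
      have "\<not> d dvd n"
      proof
        assume "d dvd n"
        then obtain c where c: "n = d * c" by auto
        moreover have "c \<noteq> 0" "c \<noteq> 1" using c d m n by (auto intro: gr0I)
        hence "c \<ge> 2" by simp
        hence "d * 2 \<le> d * c" by (rule mult_le_mono2)
        ultimately have "d * 2 \<le> n" by simp
        hence "d \<le> n div 2" by linarith
        thus False using d by auto
      qed
      thus "real (irreducible_count K d) * (of_bool (d dvd n) * real d) = 0" by simp
    qed
  qed (auto simp: m)
  also have "\<dots> \<le> (\<Sum>d=1..n div 2. ?q ^ d)"
  proof (rule sum_mono)
    fix d assume "d \<in> {1..n div 2}"
    hence "real (irreducible_count K d) * real d \<le> ?q ^ d" by (intro upper) auto
    thus "real (irreducible_count K d) * (of_bool (d dvd n) * real d) \<le> ?q ^ d" by simp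
  qed
  also have "\<dots> \<le> 2 * ?q ^ (n div 2)" by (rule sum_power_le[OF q2])
  finally show "?q ^ n - real (irreducible_count K n) * real n \<le> 2 * ?q ^ (n div 2)" .
qed

section \<open>Tails and convolutions of real sequences\<close>

lemma bigo_cmult:
  fixes f g :: "nat \<Rightarrow> real"
  shows "f \<in> O(g) \<Longrightarrow> (\<lambda>n. c * f n) \<in> O(g)"
  by (cases "c = 0") auto

text \<open>The factor \<open>s + 1\<close> accounts for the number of terms in a Cauchy product.\<close>

lemma geometric_tail_bigo:
  fixes w :: "nat \<Rightarrow> real"
  assumes \<rho>: "0 < \<rho>" "\<rho> < 1" and w: "\<And>s. \<bar>w s\<bar> \<le> (real s + 1) * \<rho> ^ s" and S: "w sums S"
  shows "(\<lambda>n. (\<Sum>s\<le>n. w s) - S) \<in> O(\<lambda>n. real n * \<rho> ^ n)"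
proof -
  have "summable (\<lambda>i. (real i + 2) * \<rho> ^ i)"
  proof (rule summable_comparison_test_bigo)
    show "summable (\<lambda>i. norm (1 / real i ^ 2))"
      by (simp add: inverse_power_summable[of 2, where 'a=real, unfolded inverse_eq_divide])
    show "(\<lambda>i. (real i + 2) * \<rho> ^ i) \<in> O(\<lambda>i. 1 / real i ^ 2)" using \<rho> by real_asymp
  qed
  define C where "C = (\<Sum>i. (real i + 2) * \<rho> ^ i)"
  have C: "(\<lambda>i. (real i + 2) * \<rho> ^ i) sums C"
    using \<open>summable _\<close> by (simp add: C_def summable_sums)
  have main: "\<bar>(\<Sum>s\<le>n. w s) - S\<bar> \<le> (real n + 1) * \<rho> ^ n * C" for n
  proof -
    have tail: "(\<lambda>i. w (i + Suc n)) sums (S - (\<Sum>s\<le>n. w s))"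
      using sums_split_initial_segment[OF S, of "Suc n"] by (simp add: lessThan_Suc_atMost)
    have maj: "(\<lambda>i. (real n + 1) * \<rho> ^ n * ((real i + 2) * \<rho> ^ i)) sums ((real n + 1) * \<rho> ^ n * C)"
      by (rule sums_mult[OF C])
    have le: "\<bar>w (i + Suc n)\<bar> \<le> (real n + 1) * \<rho> ^ n * ((real i + 2) * \<rho> ^ i)" for i
    proof -
      have "\<bar>w (i + Suc n)\<bar> \<le> (real (i + Suc n) + 1) * \<rho> ^ (i + Suc n)" by (rule w)
      also have "\<dots> \<le> ((real n + 1) * (real i + 2)) * \<rho> ^ (i + n)"
      proof (rule mult_mono)
        have "0 \<le> real n * real i + real n" by simp
        also have "\<dots> = (real n + 1) * (real i + 2) - (real (i + Suc n) + 1)"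
          by (simp add: algebra_simps)
        finally show "real (i + Suc n) + 1 \<le> (real n + 1) * (real i + 2)" by simp
        show "\<rho> ^ (i + Suc n) \<le> \<rho> ^ (i + n)" using \<rho> by (intro power_decreasing) auto
      qed (use \<rho> in auto)
      also have "\<dots> = (real n + 1) * \<rho> ^ n * ((real i + 2) * \<rho> ^ i)"
        by (simp add: power_add mult_ac)
      finally show ?thesis .
    qed
    have "\<bar>S - (\<Sum>s\<le>n. w s)\<bar> \<le> (real n + 1) * \<rho> ^ n * C"
    proof (rule abs_leI)
      show "S - (\<Sum>s\<le>n. w s) \<le> (real n + 1) * \<rho> ^ n * C"
        by (rule sums_le[OF _ tail maj]) (use le in \<open>auto dest: abs_le_D1\<close>)
      show "- (S - (\<Sum>s\<le>n. w s)) \<le> (real n + 1) * \<rho> ^ n * C"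
        by (rule sums_le[OF _ sums_minus[OF tail] maj]) (use le in \<open>auto dest: abs_le_D2\<close>)
    qed
    thus ?thesis by (simp add: abs_minus_commute)
  qed
  show ?thesis
  proof (rule bigoI)
    show "\<forall>\<^sub>F n in sequentially. norm ((\<Sum>s\<le>n. w s) - S) \<le> (2 * C) * norm (real n * \<rho> ^ n)"
      using eventually_ge_at_top[of 1]
    proof eventually_elim
      case (elim n)
      have C0: "C \<ge> 0" by (rule sums_le[OF _ sums_zero C]) (use \<rho> in auto)
      have "\<bar>(\<Sum>s\<le>n. w s) - S\<bar> \<le> (real n + 1) * (\<rho> ^ n * C)" using main[of n] by (simp add: mult_ac)
      also have "\<dots> \<le> (2 * real n) * (\<rho> ^ n * C)"
        using elim C0 \<rho> by (intro mult_right_mono) auto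
      finally show ?case using \<rho> by (simp add: abs_mult mult_ac)
    qed
  qed
qed

lemma sum_triangle_conv:
  fixes e g :: "nat \<Rightarrow> real"
  shows "(\<Sum>s\<le>n. \<Sum>i\<le>s. e i * g (s - i)) = (\<Sum>m\<le>n. e m * (\<Sum>j\<le>n - m. g j))"
proof (induction n)
  case (Suc n)
  have "(\<Sum>m\<le>Suc n. e m * (\<Sum>j\<le>Suc n - m. g j))
      = (\<Sum>m\<le>n. e m * ((\<Sum>j\<le>n - m. g j) + g (Suc n - m))) + e (Suc n) * g 0"
    by (auto intro!: sum.cong simp: Suc_diff_le)
  thus ?case by (simp add: Suc sum.distrib distrib_left)
qed auto

text \<open>Summability with the weight \<open>(m + 1)\<^sup>2\<close> is the form of rapid convergence used for \<open>k = 1\<close>: it makes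
  the tail so small that it may be multiplied by \<open>n\<close>.\<close>

lemma weighted_tail:
  fixes e :: "nat \<Rightarrow> real"
  assumes "summable (\<lambda>m. \<bar>e m\<bar> * (real m + 1)\<^sup>2)"
  defines "M \<equiv> \<Sum>m. \<bar>e m\<bar> * (real m + 1)\<^sup>2"
  shows summable_of_weighted: "summable e"
    and abs_tail_le: "\<bar>suminf e - (\<Sum>m\<le>n. e m)\<bar> \<le> M / (real n + 1)\<^sup>2"
proof -
  have M: "(\<lambda>m. \<bar>e m\<bar> * (real m + 1)\<^sup>2) sums M"
    using assms by (simp add: summable_sums)
  have "summable (\<lambda>m. \<bar>e m\<bar>)"
  proof (rule summable_comparison_test'[OF assms(1)])
    fix m :: nat
    have "\<bar>e m\<bar> * 1 \<le> \<bar>e m\<bar> * (real m + 1)\<^sup>2" by (intro mult_left_mono one_le_power) auto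
    thus "norm \<bar>e m\<bar> \<le> \<bar>e m\<bar> * (real m + 1)\<^sup>2" by simp
  qed
  thus e: "summable e" by (rule summable_rabs_cancel)
  have tail: "(\<lambda>i. e (i + Suc n)) sums (suminf e - (\<Sum>m\<le>n. e m))"
    using sums_split_initial_segment[OF summable_sums[OF e], of "Suc n"]
    by (simp add: lessThan_Suc_atMost)
  have maj: "(\<lambda>i. \<bar>e (i + Suc n)\<bar> * (real (i + Suc n) + 1)\<^sup>2) sums
      (M - (\<Sum>m\<le>n. \<bar>e m\<bar> * (real m + 1)\<^sup>2))"
    using sums_split_initial_segment[OF M, of "Suc n"] by (simp add: lessThan_Suc_atMost)
  have le: "(real n + 1)\<^sup>2 * \<bar>e (i + Suc n)\<bar> \<le> \<bar>e (i + Suc n)\<bar> * (real (i + Suc n) + 1)\<^sup>2" for i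
    by (subst mult.commute, intro mult_left_mono power_mono) auto
  have M': "M - (\<Sum>m\<le>n. \<bar>e m\<bar> * (real m + 1)\<^sup>2) \<le> M"
    by (simp add: sum_nonneg)
  have "(real n + 1)\<^sup>2 * (suminf e - (\<Sum>m\<le>n. e m)) \<le> M - (\<Sum>m\<le>n. \<bar>e m\<bar> * (real m + 1)\<^sup>2)"
  proof (rule sums_le[OF _ sums_mult[OF tail] maj])
    fix i
    have "(real n + 1)\<^sup>2 * e (i + Suc n) \<le> (real n + 1)\<^sup>2 * \<bar>e (i + Suc n)\<bar>"
      by (intro mult_left_mono) auto
    thus "(real n + 1)\<^sup>2 * e (i + Suc n) \<le> \<bar>e (i + Suc n)\<bar> * (real (i + Suc n) + 1)\<^sup>2"
      using le[of i] by linarith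
  qed
  moreover have "(real n + 1)\<^sup>2 * (- (suminf e - (\<Sum>m\<le>n. e m))) \<le> M - (\<Sum>m\<le>n. \<bar>e m\<bar> * (real m + 1)\<^sup>2)"
  proof (rule sums_le[OF _ sums_mult[OF sums_minus[OF tail]] maj])
    fix i
    have "(real n + 1)\<^sup>2 * - e (i + Suc n) \<le> (real n + 1)\<^sup>2 * \<bar>e (i + Suc n)\<bar>"
      by (intro mult_left_mono) auto
    thus "(real n + 1)\<^sup>2 * - e (i + Suc n) \<le> \<bar>e (i + Suc n)\<bar> * (real (i + Suc n) + 1)\<^sup>2"
      using le[of i] by linarith
  qed
  ultimately have "(real n + 1)\<^sup>2 * \<bar>suminf e - (\<Sum>m\<le>n. e m)\<bar> \<le> M"
    using M' by (cases "suminf e - (\<Sum>m\<le>n. e m) \<ge> 0") (auto simp: abs_if)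
  thus "\<bar>suminf e - (\<Sum>m\<le>n. e m)\<bar> \<le> M / (real n + 1)\<^sup>2"
    by (simp add: pos_le_divide_eq mult.commute)
qed

lemma summable_weighted_of_geometric:
  fixes e :: "nat \<Rightarrow> real"
  assumes "0 < \<rho>" "\<rho> < 1" "\<And>m. \<bar>e m\<bar> \<le> C * \<rho> ^ m"
  shows "summable (\<lambda>m. \<bar>e m\<bar> * (real m + 1)\<^sup>2)"
proof (rule summable_comparison_test_bigo)
  show "summable (\<lambda>i. norm (1 / real i ^ 2))"
    by (simp add: inverse_power_summable[of 2, where 'a=real, unfolded inverse_eq_divide])
  have "(\<lambda>m. \<bar>e m\<bar>) \<in> O(\<lambda>m. \<rho> ^ m)"
    using assms by (intro bigoI[of _ C] always_eventually) auto
  hence "(\<lambda>m. \<bar>e m\<bar> * (real m + 1)\<^sup>2) \<in> O(\<lambda>m. \<rho> ^ m * (real m + 1)\<^sup>2)"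
    by (intro landau_o.big.mult) auto
  also have "(\<lambda>m. \<rho> ^ m * (real m + 1)\<^sup>2) \<in> O(\<lambda>i. 1 / real i ^ 2)" using assms(1,2) by real_asymp
  finally show "(\<lambda>m. \<bar>e m\<bar> * (real m + 1)\<^sup>2) \<in> O(\<lambda>i. 1 / real i ^ 2)" .
qed

lemma sum_bigo_of_weighted:
  fixes e :: "nat \<Rightarrow> real"
  assumes "summable (\<lambda>m. \<bar>e m\<bar> * (real m + 1)\<^sup>2)"
  shows "(\<lambda>n. (\<Sum>m\<le>n. e m) - suminf e) \<in> O(\<lambda>n. 1 / real n)"
proof -
  define M where "M = (\<Sum>m. \<bar>e m\<bar> * (real m + 1)\<^sup>2)"
  have "(\<lambda>n. (\<Sum>m\<le>n. e m) - suminf e) \<in> O(\<lambda>n. 1 / (real n + 1)\<^sup>2)"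
    using abs_tail_le[OF assms] by (intro bigoI[of _ M] always_eventually)
      (auto simp: M_def abs_minus_commute)
  also have "(\<lambda>n. 1 / (real n + 1)\<^sup>2) \<in> O(\<lambda>n. 1 / real n)" by real_asymp
  finally show ?thesis .
qed

text \<open>A rapidly converging series convolved with a function whose increments are at most those of the
  harmonic numbers.  The point is \<open>\<bar>F (n - m) - F n\<bar> \<le> (m + 1)\<^sup>2 / n\<close>, together with the trivial bound
  \<open>\<bar>F n\<bar> \<le> n\<close> for the tail of \<open>e\<close>.\<close>

lemma conv_slow_bigo:
  fixes e F :: "nat \<Rightarrow> real"
  assumes e: "summable (\<lambda>m. \<bar>e m\<bar> * (real m + 1)\<^sup>2)"
    and F0: "F 0 = 0" and F: "\<And>j. \<bar>F (Suc j) - F j\<bar> \<le> 1 / real (Suc j)"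
  shows "(\<lambda>n. (\<Sum>m\<le>n. e m * F (n - m)) - suminf e * F n) \<in> O(\<lambda>n. 1 / real n)"
proof -
  define M where "M = (\<Sum>m. \<bar>e m\<bar> * (real m + 1)\<^sup>2)"
  have M0: "M \<ge> 0" unfolding M_def by (rule suminf_nonneg[OF e]) auto
  have diff: "\<bar>F (p + m) - F p\<bar> \<le> real m / (real p + 1)" for p m
  proof (induction m)
    case (Suc m)
    have "\<bar>F (Suc (p + m)) - F (p + m)\<bar> \<le> 1 / real (Suc (p + m))" by (rule F)
    also have "\<dots> \<le> 1 / (real p + 1)" by (intro divide_left_mono) auto
    finally have "\<bar>F (p + Suc m) - F p\<bar> \<le> real m / (real p + 1) + 1 / (real p + 1)"
      using Suc by simp
    thus ?case by (simp add: add_divide_distrib)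
  qed auto
  have main: "\<bar>(\<Sum>m\<le>n. e m * F (n - m)) - suminf e * F n\<bar> \<le> 2 * M / real n" if n: "n \<ge> 1" for n
  proof -
    have Fn: "\<bar>F n\<bar> \<le> real n" using diff[of 0 n] F0 by simp
    have shift: "\<bar>F (n - m) - F n\<bar> \<le> (real m + 1)\<^sup>2 / real n" if m: "m \<le> n" for m
    proof -
      define p where "p = n - m"
      have p: "n = p + m" using m by (simp add: p_def)
      have "\<bar>F (n - m) - F n\<bar> \<le> real m / (real p + 1)"
        using diff[of p m] by (simp add: p abs_minus_commute)
      also have "\<dots> \<le> (real m + 1)\<^sup>2 / real n"
      proof -
        have "real m * real n \<le> (real m + 1)\<^sup>2 * (real p + 1)"
          unfolding p by (simp add: power2_eq_square algebra_simps)
        thus ?thesis using n by (simp add: field_simps)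
      qed
      finally show ?thesis .
    qed
    have "\<bar>\<Sum>m\<le>n. e m * (F (n - m) - F n)\<bar> \<le> (\<Sum>m\<le>n. \<bar>e m\<bar> * (real m + 1)\<^sup>2 / real n)"
    proof (rule order.trans[OF sum_abs], rule sum_mono)
      fix m assume "m \<in> {..n}"
      hence "\<bar>e m\<bar> * \<bar>F (n - m) - F n\<bar> \<le> \<bar>e m\<bar> * ((real m + 1)\<^sup>2 / real n)"
        by (intro mult_left_mono shift) auto
      thus "\<bar>e m * (F (n - m) - F n)\<bar> \<le> \<bar>e m\<bar> * (real m + 1)\<^sup>2 / real n"
        by (simp add: abs_mult)
    qed
    also have "\<dots> = (\<Sum>m\<le>n. \<bar>e m\<bar> * (real m + 1)\<^sup>2) / real n" by (rule sum_divide_distrib[symmetric])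
    also have "\<dots> \<le> M / real n"
      unfolding M_def by (intro divide_right_mono sum_le_suminf e) auto
    finally have 1: "\<bar>\<Sum>m\<le>n. e m * (F (n - m) - F n)\<bar> \<le> M / real n" .
    have "\<bar>F n * (suminf e - (\<Sum>m\<le>n. e m))\<bar> \<le> real n * (M / (real n + 1)\<^sup>2)"
      unfolding abs_mult M_def by (intro mult_mono Fn abs_tail_le e) auto
    also have "\<dots> \<le> M / real n"
    proof -
      have "real n * real n \<le> (real n + 1)\<^sup>2" by (simp add: power2_eq_square algebra_simps)
      hence "M * (real n * real n) \<le> M * (real n + 1)\<^sup>2" using M0 by (intro mult_left_mono) auto
      thus ?thesis using n by (simp add: field_simps)
    qed
    finally have 2: "\<bar>F n * (suminf e - (\<Sum>m\<le>n. e m))\<bar> \<le> M / real n" .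
    have "(\<Sum>m\<le>n. e m * F (n - m)) - suminf e * F n
        = (\<Sum>m\<le>n. e m * (F (n - m) - F n)) - F n * (suminf e - (\<Sum>m\<le>n. e m))"
      by (simp add: right_diff_distrib sum_subtractf mult.commute flip: sum_distrib_left)
    thus ?thesis using 1 2 by (simp add: add_divide_distrib)
  qed
  show ?thesis
  proof (rule bigoI)
    show "\<forall>\<^sub>F n in sequentially. norm ((\<Sum>m\<le>n. e m * F (n - m)) - suminf e * F n)
        \<le> (2 * M) * norm (1 / real n)"
      using eventually_ge_at_top[of 1] by eventually_elim (use main in auto)
  qed
qed

lemma sum_inverse_atMost: "(\<Sum>j\<le>n. inverse (real j)) = harm n"
  by (induction n) (simp_all add: harm_Suc harm_def)

text \<open>The convolution square of \<open>1/j\<close>.  The terms for \<open>i = 0\<close> and \<open>i = s\<close> vanish because \<open>inverse 0 = 0\<close>.\<close>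

lemma harm_triangle:
  "(\<Sum>s\<le>n. \<Sum>i\<le>s. inverse (real i) * inverse (real (s - i)))
     = (harm n)\<^sup>2 - (\<Sum>s\<le>n. inverse (real s) ^ 2)"
proof (induction n)
  case (Suc n)
  have "inverse (real i) * inverse (real (Suc n - i))
      = (inverse (real i) + inverse (real (Suc n - i))) / real (Suc n)" if "i \<in> {1..n}" for i
  proof -
    \<comment> \<open>Partial fractions; the common denominator \<open>i + j = n + 1\<close> does not depend on \<open>i\<close>.\<close>
    define j where "j = Suc n - i"
    have "Suc n = i + j" "i > 0" "j > 0" using that by (auto simp: j_def)
    moreover from this have "Suc n - i = j" by simp
    moreover have "1 / x * (1 / y) = (1 / x + 1 / y) / (x + y)" if "x > 0" "y > 0" for x y :: real
    proof -
      have "1 / x + 1 / y = (x + y) * (1 / x * (1 / y))" using that by (simp add: field_simps)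
      thus ?thesis using that by simp
    qed
    ultimately show ?thesis by (simp only: inverse_eq_divide of_nat_add of_nat_0_less_iff)
  qed
  hence "(\<Sum>i=1..n. inverse (real i) * inverse (real (Suc n - i)))
      = (\<Sum>i=1..n. (inverse (real i) + inverse (real (Suc n - i))) / real (Suc n))"
    by (rule sum.cong[OF refl])
  also have "\<dots> = ((\<Sum>i=1..n. inverse (real i)) + (\<Sum>i=1..n. inverse (real (Suc n - i)))) / real (Suc n)"
    by (simp only: sum_divide_distrib[symmetric] sum.distrib)
  also have "(\<Sum>i=1..n. inverse (real (Suc n - i))) = (\<Sum>i=1..n. inverse (real i))"
    by (rule sum.reindex_bij_witness[of _ "\<lambda>i. Suc n - i" "\<lambda>i. Suc n - i"]) auto
  also have "(\<Sum>i=1..n. inverse (real i)) = harm n" by (simp add: harm_def)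
  finally have 1: "(\<Sum>i=1..n. inverse (real i) * inverse (real (Suc n - i)))
      = 2 * harm n / real (Suc n)" by simp
  have "(\<Sum>i\<le>Suc n. inverse (real i) * inverse (real (Suc n - i)))
      = (\<Sum>i=1..n. inverse (real i) * inverse (real (Suc n - i)))"
    by (rule sum.mono_neutral_right) (auto simp: not_le Suc_le_eq)
  thus ?case
    using Suc 1 by (simp add: harm_Suc power2_eq_square algebra_simps inverse_eq_divide)
qed (simp add: harm_def)

lemma harm_asymptotics: "(\<lambda>n. harm n - ln (real n) - euler_mascheroni) \<in> O(\<lambda>n. 1 / real n)"
proof (rule bigoI)
  show "\<forall>\<^sub>F n in sequentially. norm (harm n - ln (real n) - euler_mascheroni) \<le> 1 * norm (1 / real n)"
    using eventually_ge_at_top[of 1]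
  proof eventually_elim
    case (elim n)
    have "ln (real (Suc n)) - ln (real n) \<le> 1 / real n"
    proof -
      have "ln (real (Suc n)) - ln (real n) = ln (1 + 1 / real n)"
      proof -
        have "real (Suc n) = real n * (1 + 1 / real n)" using elim by (simp add: distrib_left)
        moreover have "1 + 1 / real n > 0" by (intro add_pos_nonneg) auto
        ultimately show ?thesis using elim by (simp only: ln_mult_pos)
      qed
      also have "\<dots> \<le> 1 / real n" by (rule ln_add_one_self_le_self) simp
      finally show ?thesis .
    qed
    moreover have "ln (real n) \<le> ln (real (Suc n))" using elim by simp
    moreover have "inverse (real (2 * (n + 1))) \<ge> 0" "inverse (real (2 * n)) \<le> 1 / real n"
      using elim by (auto simp: inverse_eq_divide intro!: divide_left_mono)
    moreover have "euler_mascheroni \<le> harm n - ln (real (Suc n)) + inverse (real (2 * n))"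
        "euler_mascheroni \<ge> harm n - ln (real (Suc n)) + inverse (real (2 * (n + 1)))"
      using euler_mascheroni_bounds[OF elim] by (simp_all only: atLeastAtMost_iff)
    ultimately have "\<bar>harm n - ln (real n) - euler_mascheroni\<bar> \<le> 1 / real n"
      unfolding abs_le_iff by linarith
    thus ?case by simp
  qed
qed

lemma inverse_squares_asymptotics:
  "(\<lambda>n. (\<Sum>s\<le>n. inverse (real s) ^ 2) - pi\<^sup>2 / 6) \<in> O(\<lambda>n. 1 / real n)"
proof -
  have *: "\<bar>(\<Sum>s\<le>n. inverse (real s) ^ 2) - pi\<^sup>2 / 6\<bar> \<le> 1 / real n" if n: "n \<ge> 1" for n
  proof -
    have eq: "(\<Sum>s\<le>n. inverse (real s) ^ 2) = (\<Sum>i<n. 1 / (real i + 1)\<^sup>2)"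
      by (simp add: sum.atMost_shift power_inverse inverse_eq_divide add.commute power_one_over)
    have tail: "(\<lambda>i. 1 / (real (i + n) + 1)\<^sup>2) sums (pi\<^sup>2 / 6 - (\<Sum>s\<le>n. inverse (real s) ^ 2))"
      unfolding eq using sums_split_initial_segment[OF inverse_squares_sums, of n] by (simp add: add_ac)
    \<comment> \<open>The tail of the series is dominated by the telescoping series of \<open>1 / (x * (x + 1))\<close>.\<close>
    have tel: "(\<lambda>i. 1 / real (i + n) - 1 / real (Suc i + n)) sums (1 / real (0 + n) - 0)"
      by (rule telescope_sums') real_asymp
    have "0 \<le> pi\<^sup>2 / 6 - (\<Sum>s\<le>n. inverse (real s) ^ 2)"
      by (rule sums_le[OF _ sums_zero tail]) auto
    moreover have "pi\<^sup>2 / 6 - (\<Sum>s\<le>n. inverse (real s) ^ 2) \<le> 1 / real (0 + n) - 0"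
    proof (rule sums_le[OF _ tail tel])
      fix i
      show "1 / (real (i + n) + 1)\<^sup>2 \<le> 1 / real (i + n) - 1 / real (Suc i + n)"
      proof -
        define x where "x = real (i + n)"
        have x: "x > 0" using n by (simp add: x_def)
        have "1 / (x + 1)\<^sup>2 \<le> 1 / (x * (x + 1))"
          using x by (intro divide_left_mono) (auto simp: power2_eq_square)
        also have "\<dots> = 1 / x - 1 / (x + 1)" using x by (simp add: field_simps)
        finally show ?thesis by (simp add: x_def add_ac)
      qed
    qed
    ultimately show ?thesis by simp
  qed
  show ?thesis
  proof (rule bigoI)
    show "\<forall>\<^sub>F n in sequentially. norm ((\<Sum>s\<le>n. inverse (real s) ^ 2) - pi\<^sup>2 / 6) \<le> 1 * norm (1 / real n)"
      using eventually_ge_at_top[of 1] by eventually_elim (use * in auto)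
  qed
qed

section \<open>The series for L and the case \<open>k \<ge> 2\<close>\<close>

text \<open>Otherwise simplification turns the index of \<open>L_coeff K 1\<close> and \<open>L_partial K 1\<close> into \<open>Suc 0\<close>,
  and the lemmas about index \<open>1\<close> no longer match.\<close>

declare One_nat_def [simp del]

lemma L_coeff_nonneg: "L_coeff K m j \<ge> 0"
  by (simp add: L_coeff_def)

lemma L_coeff_0:
  fixes K :: "'a::{field,finite} itself"
  shows "m \<ge> 1 \<Longrightarrow> L_coeff K m 0 = 0"
proof -
  assume "m \<ge> 1"
  hence "{l \<in> monic_irreducibles :: 'a poly set. m * degree l = 0} = {}"
    using monic_irreducible_degree_pos by fastforce
  thus "L_coeff K m 0 = 0" by (simp only: L_coeff_def card.empty of_nat_0 div_0)
qed

lemma L_coeff_1: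
  fixes K :: "'a::{field,finite} itself"
  shows "L_coeff K 1 j = real (irreducible_count K j) / real CARD('a) ^ j"
  by (simp add: L_coeff_def irreducible_count_def)

lemma L_coeff_1_le:
  assumes "j > 0"
  shows "L_coeff K 1 j \<le> 1 / real j"
  using irreducible_count_upper[OF assms, of K] assms by (simp add: L_coeff_1 field_simps)

text \<open>Only \<open>j = m * d\<close> contributes, where \<open>\<pi>\<^sub>q(d) \<le> q ^ d = q powr (j/m)\<close>.\<close>

lemma L_coeff_le:
  fixes K :: "'a::{field,finite} itself"
  assumes k: "k \<ge> 1" "m \<ge> k"
  shows "L_coeff K m j \<le> (real CARD('a) powr (1 / real k - 1)) ^ j"
proof (cases "m dvd j \<and> j > 0")
  case True
  let ?q = "real CARD('a)"
  have q: "?q \<ge> 2" using card_field_ge_2[where 'a='a] by simp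
  obtain d where d: "j = m * d" using True by auto
  have d0: "d > 0" and m0: "m > 0" using d True by auto
  have "{l \<in> monic_irreducibles :: 'a poly set. m * degree l = j}
      = {l \<in> monic_irreducibles. degree l = d}"
    using d m0 by auto
  hence u: "L_coeff K m j = real (irreducible_count K d) / ?q ^ j"
    by (simp add: L_coeff_def irreducible_count_def)
  have "real (irreducible_count K d) * 1 \<le> real (irreducible_count K d) * real d"
    using d0 by (intro mult_left_mono) auto
  also have "\<dots> \<le> ?q ^ d" by (rule irreducible_count_upper[OF d0])
  also have "\<dots> = ?q powr real d" by (simp add: powr_realpow)
  also have "\<dots> \<le> ?q powr (real j / real k)"
  proof (rule powr_mono)
    have "real k * real d \<le> real m * real d" using k by (intro mult_right_mono) auto
    thus "real d \<le> real j / real k" using k by (simp add: d field_simps)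
  qed (use q in auto)
  finally have "L_coeff K m j \<le> ?q powr (real j / real k) / ?q ^ j"
    unfolding u by (intro divide_right_mono) auto
  also have "\<dots> = ?q powr (real j / real k - real j)"
    using q by (simp add: powr_diff powr_realpow)
  also have "real j / real k - real j = (1 / real k - 1) * real j" by (simp add: algebra_simps)
  also have "?q powr \<dots> = (?q powr (1 / real k - 1)) ^ j"
    using q by (simp add: powr_powr[symmetric] powr_realpow)
  finally show ?thesis .
next
  case False
  have "L_coeff K m j = 0"
  proof (cases "j = 0")
    case True
    thus ?thesis using k by (simp add: L_coeff_0)
  next
    case j: False
    hence "{l \<in> monic_irreducibles :: 'a poly set. m * degree l = j} = {}" using False by auto
    thus ?thesis by (simp add: L_coeff_def del: Collect_empty_eq)
  qed
  thus ?thesis by simp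
qed

lemma decay_rate_bounds:
  fixes K :: "'a::{field,finite} itself"
  assumes "k \<ge> 2"
  shows "0 < real CARD('a) powr (1 / real k - 1)" "real CARD('a) powr (1 / real k - 1) < 1"
  using card_field_ge_2[where 'a='a] assms by (auto intro!: powr_less_one)

text \<open>The sum over irreducibles is regrouped by the value of \<open>m * degree l\<close>.\<close>

lemma L_coeff_sums_L:
  fixes K :: "'a::{field,finite} itself"
  assumes m: "m \<ge> 2"
  shows "L_coeff K m sums L K m"
proof -
  let ?q = "real CARD('a)"
  let ?B = "\<lambda>j. {l \<in> monic_irreducibles :: 'a poly set. m * degree l = j}"
  let ?f = "\<lambda>l :: 'a poly. 1 / real (poly_size l) ^ m"
  have "summable (L_coeff K m)"
  proof (rule summable_comparison_test')
    show "summable (\<lambda>j. (?q powr (1 / real m - 1)) ^ j)"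
      using decay_rate_bounds[where 'a='a, OF m] by (intro summable_geometric) simp
    show "norm (L_coeff K m j) \<le> (?q powr (1 / real m - 1)) ^ j" for j
      using L_coeff_le[of m m K j] m by (simp add: L_coeff_nonneg)
  qed
  hence sums: "L_coeff K m sums suminf (L_coeff K m)" by (rule summable_sums)
  hence hs: "(L_coeff K m has_sum suminf (L_coeff K m)) UNIV"
    by (rule sums_nonneg_imp_has_sum) (rule L_coeff_nonneg)
  have fin: "finite (?B j)" for j
  proof (rule finite_subset[OF _ finite_small_irreducibles[of K j]])
    show "?B j \<subseteq> small_irreducibles K j"
      using m by (auto simp: small_irreducibles_def)
  qed
  have sumB: "(\<Sum>l\<in>?B j. ?f l) = L_coeff K m j" for j
  proof -
    have "(\<Sum>l\<in>?B j. ?f l) = (\<Sum>l\<in>?B j. 1 / ?q ^ j)"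
      by (rule sum.cong) (auto simp: poly_size_def power_mult[symmetric] mult.commute)
    thus ?thesis by (simp add: L_coeff_def)
  qed
  have inner: "((\<lambda>l. ?f l) has_sum L_coeff K m j) (?B j)" for j
    unfolding sumB[symmetric] by (rule has_sum_finite[OF fin])
  have "((\<lambda>p. ?f (snd p)) has_sum suminf (L_coeff K m)) (Sigma UNIV ?B)"
  proof (rule has_sum_SigmaI)
    show "((\<lambda>l. ?f (snd (j, l))) has_sum L_coeff K m j) (?B j)" for j using inner by simp
    have "(\<lambda>p. norm (?f (snd p))) summable_on Sigma UNIV ?B"
      unfolding Infinite_Sum.abs_summable_on_Sigma_iff
    proof (intro conjI ballI)
      show "(\<lambda>l. norm (?f (snd (j, l)))) summable_on ?B j" for j by (rule summable_on_finite[OF fin])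
      have "(\<Sum>\<^sub>\<infinity>l\<in>?B j. norm (?f (snd (j, l)))) = L_coeff K m j" for j
        using sumB by (simp add: fin)
      thus "(\<lambda>j. norm (\<Sum>\<^sub>\<infinity>l\<in>?B j. norm (?f (snd (j, l))))) summable_on UNIV"
        using hs L_coeff_nonneg[of K m] by (auto simp: summable_on_def)
    qed
    thus "(\<lambda>p. ?f (snd p)) summable_on Sigma UNIV ?B" by (rule abs_summable_summable)
  qed (rule hs)
  moreover have "inj_on snd (Sigma UNIV ?B)" by (auto simp: inj_on_def)
  moreover have "snd ` Sigma UNIV ?B = monic_irreducibles" by (auto simp: image_iff)
  ultimately have "(?f has_sum suminf (L_coeff K m)) monic_irreducibles"
    using has_sum_reindex[of snd "Sigma UNIV ?B" ?f "suminf (L_coeff K m)"] by (simp add: o_def)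
  hence "L K m = suminf (L_coeff K m)" unfolding L_def by (rule infsumI)
  with sums show ?thesis by simp
qed

lemma L_partial_asymptotics:
  fixes K :: "'a::{field,finite} itself"
  assumes "k \<ge> 2" "m \<ge> k"
  shows "(\<lambda>n. L_partial K m n - L K m)
    \<in> O(\<lambda>n. real n * (real CARD('a) powr (1 / real k - 1)) ^ n)"
  unfolding L_partial_def
proof (rule geometric_tail_bigo)
  let ?\<rho> = "real CARD('a) powr (1 / real k - 1)"
  show "\<bar>L_coeff K m s\<bar> \<le> (real s + 1) * ?\<rho> ^ s" for s
  proof -
    have "\<bar>L_coeff K m s\<bar> \<le> 1 * ?\<rho> ^ s"
      using L_coeff_le[of k m K s] assms L_coeff_nonneg[of K m s] by simp
    also have "\<dots> \<le> (real s + 1) * ?\<rho> ^ s" by (intro mult_right_mono) auto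
    finally show ?thesis .
  qed
qed (use assms decay_rate_bounds[where 'a='a, of k] L_coeff_sums_L[of m K] in auto)

lemma L_conv_asymptotics:
  fixes K :: "'a::{field,finite} itself"
  assumes "k \<ge> 2" "a \<ge> k" "b \<ge> k"
  shows "(\<lambda>n. L_conv K a b n - L K a * L K b)
    \<in> O(\<lambda>n. real n * (real CARD('a) powr (1 / real k - 1)) ^ n)"
  unfolding L_conv_def
proof (rule geometric_tail_bigo)
  let ?\<rho> = "real CARD('a) powr (1 / real k - 1)"
  show "\<bar>\<Sum>i\<le>s. L_coeff K a i * L_coeff K b (s - i)\<bar> \<le> (real s + 1) * ?\<rho> ^ s" for s
  proof -
    have "\<bar>\<Sum>i\<le>s. L_coeff K a i * L_coeff K b (s - i)\<bar> \<le> (\<Sum>i\<le>s. ?\<rho> ^ s)"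
    proof (rule order.trans[OF sum_abs], rule sum_mono)
      fix i assume "i \<in> {..s}"
      hence s: "?\<rho> ^ s = ?\<rho> ^ i * ?\<rho> ^ (s - i)" by (simp flip: power_add)
      show "\<bar>L_coeff K a i * L_coeff K b (s - i)\<bar> \<le> ?\<rho> ^ s"
        unfolding s abs_mult using assms
        by (intro mult_mono) (simp_all add: L_coeff_nonneg L_coeff_le)
    qed
    thus ?thesis by (simp add: algebra_simps)
  qed
  have *: "summable (\<lambda>i. norm (L_coeff K m i))" "suminf (L_coeff K m) = L K m" if "m \<ge> 2" for m
    using L_coeff_sums_L[OF that, of K] by (simp_all add: L_coeff_nonneg sums_iff)
  show "(\<lambda>s. \<Sum>i\<le>s. L_coeff K a i * L_coeff K b (s - i)) sums (L K a * L K b)"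
    using Cauchy_product_sums[of "L_coeff K a" "L_coeff K b"] * assms by simp
qed (use assms decay_rate_bounds[where 'a='a, of k] in auto)

lemma omega_ge_2_asymptotics:
  fixes K :: "'a::{field,finite} itself" and q :: real
  assumes q: "q = real CARD('a)" and k: "k \<ge> 2"
  shows "(\<lambda>n. (\<Sum>f\<in>(monics_of_degree n :: 'a poly set). (real (omega k f))\<^sup>2) - c' K k * q ^ n)
          \<in> O(\<lambda>n. real n * q powr (real n / real k))"
proof -
  define \<rho> where "\<rho> = q powr (1 / real k - 1)"
  have q2: "q \<ge> 2" using card_field_ge_2[where 'a='a] q by simp
  define d where "d m n = L_partial K m n - L K m" for m n
  define t where "t a b n = L_conv K a b n - L K a * L K b" for a b n
  define err where "err n = d k n - d (k + 1) n + t k k n - 2 * t k (k + 1) n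
      + t (k + 1) (k + 1) n - d (2 * k) n + 2 * d (2 * k + 1) n - d (2 * k + 2) n" for n
  have d: "d m \<in> O(\<lambda>n. real n * \<rho> ^ n)" if "m \<ge> k" for m
    unfolding d_def \<rho>_def q by (rule L_partial_asymptotics[OF k that])
  have t: "t a b \<in> O(\<lambda>n. real n * \<rho> ^ n)" if "a \<ge> k" "b \<ge> k" for a b
    unfolding t_def \<rho>_def q by (rule L_conv_asymptotics[OF k that])
  have "err \<in> O(\<lambda>n. real n * \<rho> ^ n)"
    unfolding err_def by (intro sum_in_bigo bigo_cmult d t) auto
  hence "(\<lambda>n. q ^ n * err n) \<in> O(\<lambda>n. q ^ n * (real n * \<rho> ^ n))"
    by (intro landau_o.big.mult) auto
  also have "(\<lambda>n. q ^ n * (real n * \<rho> ^ n)) = (\<lambda>n. real n * q powr (real n / real k))"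
  proof
    fix n
    have "q ^ n * \<rho> ^ n = q powr real n * q powr ((1 / real k - 1) * real n)"
      using q2 by (simp add: \<rho>_def powr_powr[symmetric] powr_realpow)
    also have "\<dots> = q powr (real n / real k)"
      by (simp add: powr_add[symmetric] algebra_simps)
    finally show "q ^ n * (real n * \<rho> ^ n) = real n * q powr (real n / real k)"
      by (simp add: mult_ac)
  qed
  also have "(\<lambda>n. q ^ n * err n)
      = (\<lambda>n. (\<Sum>f\<in>(monics_of_degree n :: 'a poly set). (real (omega k f))\<^sup>2) - c' K k * q ^ n)"
  proof
    fix n
    have "k \<ge> 1" using k by simp
    show "q ^ n * err n
      = (\<Sum>f\<in>(monics_of_degree n :: 'a poly set). (real (omega k f))\<^sup>2) - c' K k * q ^ n"
      unfolding sum_omega_sq_eq[OF \<open>k \<ge> 1\<close>, of n K] q[symmetric] err_def d_def t_def c'_def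
      by (simp add: algebra_simps)
  qed
  finally show ?thesis .
qed

section \<open>The case \<open>k = 1\<close>\<close>

text \<open>The error term of the prime polynomial theorem, relative to \<open>q ^ j\<close>.  At \<open>j = 0\<close> both parts are
  \<open>0\<close>.\<close>

definition prime_error :: "'a::{field,finite} itself \<Rightarrow> nat \<Rightarrow> real" where
  "prime_error K j = L_coeff K 1 j - inverse (real j)"

text \<open>The base \<open>sqrt (1 / 2)\<close> is a uniform upper bound for \<open>1 / sqrt q\<close>.\<close>

lemma prime_error_bound:
  fixes K :: "'a::{field,finite} itself"
  shows "\<bar>prime_error K n\<bar> \<le> 2 * sqrt (1 / 2) ^ n"
proof (cases "n = 0")
  case True
  thus ?thesis by (simp add: prime_error_def L_coeff_0)
next
  case False
  let ?q = "real CARD('a)" and ?r = "sqrt (1 / 2) :: real"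
  have q: "?q \<ge> 2" using card_field_ge_2[where 'a='a] by simp
  have n: "n > 0" using False by simp
  have up: "L_coeff K 1 n \<le> inverse (real n)" using L_coeff_1_le[OF n, of K] by (simp add: inverse_eq_divide)
  have "inverse (real n) - L_coeff K 1 n
      = (?q ^ n - real (irreducible_count K n) * real n) / (?q ^ n * real n)"
    using n q by (simp add: L_coeff_1 field_simps)
  also have "\<dots> \<le> 2 * ?q ^ (n div 2) / (?q ^ n * real n)"
    using irreducible_count_lower[OF n, of K] by (intro divide_right_mono) auto
  also have "\<dots> \<le> 2 * ?q ^ (n div 2) / (?q ^ n * 1)"
    using n q by (intro divide_left_mono mult_left_mono) auto
  also have "\<dots> = 2 * (1 / ?q) ^ (n - n div 2)"
    using q by (simp add: power_diff power_one_over)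
  also have "\<dots> \<le> 2 * (1 / 2) ^ (n - n div 2)"
    using q by (intro mult_left_mono power_mono divide_left_mono) auto
  also have "(1 / 2) ^ (n - n div 2) = (?r\<^sup>2) ^ (n - n div 2)" by simp
  also have "\<dots> = ?r ^ (2 * (n - n div 2))" by (simp only: power_mult)
  also have "2 * \<dots> \<le> 2 * ?r ^ n"
    by (intro mult_left_mono power_decreasing) auto
  finally show ?thesis using up by (simp add: prime_error_def)
qed

lemma suminf_prime_error: "suminf (prime_error K) = c1 K"
proof -
  have s: "summable (prime_error K)"
    by (rule summable_of_weighted, rule summable_weighted_of_geometric[OF _ _ prime_error_bound]) auto
  have "c1 K = (\<Sum>i. prime_error K (Suc i))"
    by (simp add: c1_def Let_def prime_error_def L_coeff_1 diff_divide_distrib inverse_eq_divide)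
  also have "\<dots> = suminf (prime_error K)"
    using suminf_split_head[OF s] by (simp add: prime_error_def L_coeff_0)
  finally show ?thesis by simp
qed

text \<open>Substituting \<open>L_coeff K 1 j = inverse j + prime_error K j\<close> in the first factor, and then in the second
  factor of the part with \<open>inverse j\<close>.\<close>

lemma L_conv_11_eq:
  "L_conv K 1 1 n = (harm n)\<^sup>2 - (\<Sum>s\<le>n. inverse (real s) ^ 2)
     + (\<Sum>m\<le>n. prime_error K m * L_partial K 1 (n - m)) + (\<Sum>m\<le>n. prime_error K m * harm (n - m))"
proof -
  let ?h = "\<lambda>j. inverse (real j)" and ?e = "prime_error K" and ?a = "L_coeff K 1"
  have "(\<Sum>i\<le>s. ?a i * ?a (s - i))
      = (\<Sum>i\<le>s. ?h i * ?h (s - i)) + (\<Sum>i\<le>s. ?e i * ?a (s - i)) + (\<Sum>i\<le>s. ?e i * ?h (s - i))" for s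
  proof -
    have "(\<Sum>i\<le>s. ?e i * ?h (s - i)) = (\<Sum>i\<le>s. ?h i * ?e (s - i))"
      by (rule sum.reindex_bij_witness[of _ "\<lambda>i. s - i" "\<lambda>i. s - i"]) (auto simp: mult.commute)
    thus ?thesis by (simp add: prime_error_def algebra_simps flip: sum.distrib)
  qed
  thus ?thesis
    unfolding L_conv_def L_partial_def
    by (simp only: sum.distrib harm_triangle sum_triangle_conv
        sum_triangle_conv[of ?e ?h] sum_inverse_atMost)
qed

lemma omega_1_asymptotics:
  fixes K :: "'a::{field,finite} itself" and q :: real
  assumes q: "q = real CARD('a)"
  shows "(\<lambda>n. (\<Sum>f\<in>(monics_of_degree n :: 'a poly set). (real (omega 1 f))\<^sup>2)
            - (q ^ n * (ln (real n))\<^sup>2 + c2 K * q ^ n * ln (real n) + c3 K * q ^ n))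
          \<in> O(\<lambda>n. q ^ n * ln (real n) / real n)"
proof -
  let ?E = "O(\<lambda>n. 1 / real n) :: (nat \<Rightarrow> real) set"
  let ?e = "prime_error K" and ?x = "\<lambda>n. ln (real n)" and ?\<gamma> = "euler_mascheroni :: real"
  have e: "summable (\<lambda>m. \<bar>?e m\<bar> * (real m + 1)\<^sup>2)"
    by (rule summable_weighted_of_geometric[OF _ _ prime_error_bound]) auto
  define \<rho> where "\<rho> = q powr (1 / real 2 - 1)"
  have \<rho>: "0 < \<rho>" "\<rho> < 1" using decay_rate_bounds[of 2, where 'a='a] by (auto simp: \<rho>_def q)
  have small: "O(\<lambda>n. real n * \<rho> ^ n) \<subseteq> ?E"
    by (rule landau_o.big.subsetI) (use \<rho> in real_asymp)
  have u2: "summable (\<lambda>m. \<bar>L_coeff K 2 m\<bar> * (real m + 1)\<^sup>2)"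
    using L_coeff_le[of 2 2 K] L_coeff_nonneg[of K 2]
    by (intro summable_weighted_of_geometric[OF \<rho>, of _ 1]) (auto simp: \<rho>_def q)
  have A0: "L_partial K 1 0 = 0" by (simp add: L_partial_def L_coeff_0)
  have A_inc: "\<bar>L_partial K 1 (Suc j) - L_partial K 1 j\<bar> \<le> 1 / real (Suc j)" for j
    using L_coeff_1_le[of "Suc j" K] L_coeff_nonneg[of K 1 "Suc j"] by (simp add: L_partial_def)
  have harm_inc: "\<bar>harm (Suc j) - harm j\<bar> \<le> 1 / real (Suc j)" for j
    by (simp add: harm_Suc inverse_eq_divide)

  \<comment> \<open>The remainders of all approximations; each of them is \<open>O(1/n)\<close>.\<close>
  define r1 where "r1 n = harm n - ?x n - ?\<gamma>" for n
  define r2 where "r2 n = (\<Sum>m\<le>n. ?e m) - c1 K" for n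
  define r3 where "r3 n = (\<Sum>s\<le>n. inverse (real s) ^ 2) - pi\<^sup>2 / 6" for n
  define r4 where "r4 n = (\<Sum>m\<le>n. ?e m * L_partial K 1 (n - m)) - c1 K * L_partial K 1 n" for n
  define r5 where "r5 n = (\<Sum>m\<le>n. ?e m * harm (n - m)) - c1 K * harm n" for n
  define r6 where "r6 n = L_conv K 2 1 n - L K 2 * L_partial K 1 n" for n
  define r7 where "r7 n = L_conv K 2 2 n - L K 2 * L K 2" for n
  define d where "d m n = L_partial K m n - L K m" for m n
  have r: "r1 \<in> ?E" "r2 \<in> ?E" "r3 \<in> ?E" "r4 \<in> ?E" "r5 \<in> ?E" "r6 \<in> ?E" "r7 \<in> ?E"
    unfolding r1_def r2_def r3_def r4_def r5_def r6_def r7_def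
  proof -
    show "(\<lambda>n. harm n - ?x n - ?\<gamma>) \<in> ?E" by (rule harm_asymptotics)
    show "(\<lambda>n. (\<Sum>m\<le>n. ?e m) - c1 K) \<in> ?E"
      using sum_bigo_of_weighted[OF e] by (simp add: suminf_prime_error)
    show "(\<lambda>n. (\<Sum>s\<le>n. inverse (real s) ^ 2) - pi\<^sup>2 / 6) \<in> ?E"
      by (rule inverse_squares_asymptotics)
    show "(\<lambda>n. (\<Sum>m\<le>n. ?e m * L_partial K 1 (n - m)) - c1 K * L_partial K 1 n) \<in> ?E"
      using conv_slow_bigo[OF e A0 A_inc] by (simp add: suminf_prime_error)
    show "(\<lambda>n. (\<Sum>m\<le>n. ?e m * harm (n - m)) - c1 K * harm n) \<in> ?E"
      using conv_slow_bigo[OF e _ harm_inc] by (simp add: suminf_prime_error harm_def)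
    show "(\<lambda>n. L_conv K 2 1 n - L K 2 * L_partial K 1 n) \<in> ?E"
      using conv_slow_bigo[OF u2 A0 A_inc] sums_unique[OF L_coeff_sums_L[of 2 K]]
      by (simp add: L_conv_def L_partial_def sum_triangle_conv)
    show "(\<lambda>n. L_conv K 2 2 n - L K 2 * L K 2) \<in> ?E"
      using L_conv_asymptotics[of 2 2 2 K] small by (auto simp: \<rho>_def q)
  qed
  have dr: "d m \<in> ?E" if "m \<ge> 2" for m
    unfolding d_def using L_partial_asymptotics[of 2 m K] small that by (auto simp: \<rho>_def q)
  have A: "L_partial K 1 n = ?x n + A1 K + r1 n + r2 n" for n
  proof -
    have "L_partial K 1 n = harm n + (\<Sum>m\<le>n. ?e m)"
      unfolding L_partial_def sum_inverse_atMost[symmetric] by (simp add: prime_error_def flip: sum.distrib)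
    thus ?thesis by (simp add: r1_def r2_def A1_def)
  qed
  \<comment> \<open>Only the first term of \<open>err\<close>, the cross term of the square of \<open>harm n\<close>, need not be \<open>O(1/n)\<close>.\<close>
  define err where "err n = 2 * (?x n * r1 n) + r1 n * r1 n + 2 * ?\<gamma> * r1 n + 2 * c1 K * r1 n
      + c1 K * r2 n + (1 - 2 * L K 2) * (r1 n + r2 n) - r3 n + r4 n + r5 n - 2 * r6 n + r7 n
      - 2 * d 2 n + 2 * d 3 n - d 4 n" for n
  let ?F = "O(\<lambda>n. ln (real n) / real n) :: (nat \<Rightarrow> real) set"
  have EF: "f \<in> ?F" if "f \<in> ?E" for f :: "nat \<Rightarrow> real"
  proof -
    have "(\<lambda>n. 1 / real n) \<in> ?F" by real_asymp
    thus ?thesis using that landau_o.big_trans by blast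
  qed
  have x: "(\<lambda>n. ?x n * r1 n) \<in> ?F"
    using landau_o.big.mult[OF _ r(1), of ?x ?x] by simp
  have rr: "(\<lambda>n. r1 n * r1 n) \<in> ?E"
  proof -
    have "(\<lambda>n. r1 n * r1 n) \<in> O(\<lambda>n. 1 / real n * (1 / real n))"
      by (rule landau_o.big.mult[OF r(1) r(1)])
    also have "(\<lambda>n. 1 / real n * (1 / real n)) \<in> ?E" by real_asymp
    finally show ?thesis .
  qed
  have "err \<in> ?F"
    unfolding err_def
    by (intro sum_in_bigo bigo_cmult x EF[OF rr] r[THEN EF] dr[THEN EF]) auto
  hence "(\<lambda>n. q ^ n * err n) \<in> O(\<lambda>n. q ^ n * (ln (real n) / real n))"
    by (intro landau_o.big.mult) auto
  also have "(\<lambda>n. q ^ n * err n)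
    = (\<lambda>n. (\<Sum>f\<in>(monics_of_degree n :: 'a poly set). (real (omega 1 f))\<^sup>2)
            - (q ^ n * (?x n)\<^sup>2 + c2 K * q ^ n * ?x n + c3 K * q ^ n))"
  proof
    fix n
    have H: "harm n = ?x n + ?\<gamma> + r1 n" by (simp add: r1_def)
    have T11: "L_conv K 1 1 n = (harm n)\<^sup>2 - (r3 n + pi\<^sup>2 / 6) + (r4 n + c1 K * L_partial K 1 n)
        + (r5 n + c1 K * harm n)"
      unfolding L_conv_11_eq r3_def r4_def r5_def by simp
    have T12: "L_conv K 1 2 n = r6 n + L K 2 * L_partial K 1 n"
      by (simp add: r6_def L_conv_commute[of K 1 2])
    have T22: "L_conv K 2 2 n = r7 n + L K 2 * L K 2" by (simp add: r7_def)
    have D: "L_partial K m n = d m n + L K m" for m by (simp add: d_def)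
    have "(\<Sum>f\<in>(monics_of_degree n :: 'a poly set). (real (omega 1 f))\<^sup>2)
        = q ^ n * (L_partial K 1 n - L_partial K 2 n + L_conv K 1 1 n - 2 * L_conv K 1 2 n + L_conv K 2 2 n
            - L_partial K 2 n + 2 * L_partial K 3 n - L_partial K 4 n)"
    proof -
      have "(1::nat) + 1 = 2" "2 * (1::nat) = 2" "(2::nat) + 1 = 3" "(2::nat) + 2 = 4" by simp_all
      thus ?thesis using sum_omega_sq_eq[OF order.refl, of n K] by (simp only: q)
    qed
    also have "\<dots> - (q ^ n * (?x n)\<^sup>2 + c2 K * q ^ n * ?x n + c3 K * q ^ n) = q ^ n * err n"
      unfolding T11 T12 T22 H A D[of 2] D[of 3] D[of 4] err_def c2_def c3_def A1_def
      by (simp add: algebra_simps power2_eq_square)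
    finally show "q ^ n * err n = (\<Sum>f\<in>(monics_of_degree n :: 'a poly set). (real (omega 1 f))\<^sup>2)
            - (q ^ n * (?x n)\<^sup>2 + c2 K * q ^ n * ?x n + c3 K * q ^ n)" by simp
  qed
  finally show ?thesis by simp
qed

theorem theorem1p2:
  fixes K :: "'a::{field,finite} itself" and q :: real
  assumes "q = real CARD('a)"
  shows "(\<lambda>n. (\<Sum>f\<in>(monics_of_degree n :: 'a poly set). (real (omega 1 f))\<^sup>2)
            - (q ^ n * (ln (real n))\<^sup>2 + c2 K * q ^ n * ln (real n) + c3 K * q ^ n))
          \<in> O(\<lambda>n. q ^ n * ln (real n) / real n)
    \<and> (\<forall>k\<ge>2. (\<lambda>n. (\<Sum>f\<in>(monics_of_degree n :: 'a poly set). (real (omega k f))\<^sup>2)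
            - c' K k * q ^ n)
          \<in> O(\<lambda>n. real n * q powr (real n / real k)))"
  using omega_1_asymptotics[OF assms] omega_ge_2_asymptotics[OF assms] by blast

end
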